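(* Let $A, B, \alpha, \beta, \gamma, \delta \in \mathbb{R}$ and consider the ODE \[ A\,u'(z)^2 + B\,u(z)\,u''(z) = u'''(z) + \alpha\,u''(z) + \beta\,u'(z) + \gamma\,u(z) + \delta . \] Assume the following three conditions hold: (i) $AB(A+B) \neq 0$; (ii) $\dfrac{B}{A+B} \notin \mathbb{Z}\setminus\{0\}$; (iii) $\dfrac{7A+8B \pm \sqrt{25A^2+16AB-32B^2}}{2(A+2B)} \notin \mathbb{N}\cup\{0\}$, for both choices of the sign. Then every meromorphic solution $u$ of this ODE on $\mathbb{C}$ is either a rational function of the form \[ u(z) = \frac{u_0}{z-z_0} + P(z), \] where $u_0, z_0 \in \mathbb{C}$ and $P$ is a polynomial of degree at most two, or a simply periodic function of the form \[ u(z) = \frac{h_0}{e^{kz}-\zeta_0} + c_0, \qquad h_0, k, \zeta_0 \in \mathbb{C}\setminus\{0\},\ c_0 \in \mathbb{C}. \]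
   Context: A meromorphic function means a function meromorphic on the whole complex plane $\mathbb{C}$ (no singularities other than poles); the independent variable $z$ is complex. Conditions (i)–(iii) are what the paper calls the "generic case". *)

theory Defs
  imports "HOL-Complex_Analysis.Complex_Analysis" "HOL-Computational_Algebra.Polynomial"
begin

end

theory Submission
  imports Defs
begin

text \<open>
  Near a pole the equation forces a simple pole with a prescribed residue, and condition (iii)
  says that no Fuchs index is a natural number, so the Laurent expansion at a pole is unique.
  Hence the difference of any two poles is a period. With at most one pole, substitute
  \<open>z = z0 + exp s\<close>; with several poles, rescale a period of minimal modulus to \<open>2 * pi * \<i>\<close>.
  In both cases one obtains a \<open>2 * pi * \<i>\<close>-periodic function \<open>g\<close> on a half-plane satisfying a
  quadratic equation. If \<open>g\<close> grew too fast, a Wiman-Valiron type argument would give points where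
  \<open>g\<close> behaves like \<open>exp (K * s)\<close> and dominates the linear terms, so that \<open>A + B = 0\<close>. Thus \<open>g\<close> has
  moderate growth and Liouville's theorem identifies the solution up to finitely many coefficients.
  Two independent periods are impossible because all residues are equal and cannot cancel
  over a period cell.
\<close>

text \<open>Condition (ii) acts with both signs: a pole of order n >= 2 would need
  \<open>B / (A + B) = - n\<close>, and a polynomial part of degree n >= 3 would need
  \<open>B / (A + B) = n\<close>. The classical Wiman-Valiron method reads its estimates off the
  power series of an entire function. Solutions here have poles, so the method is transferred to a
  pole-free half-plane: there the period makes each vertical strip of finite width compact modulo
  translation, and weighted moduli attain their maxima. The substitution by \<open>exp\<close>
  supplies a period when the solution has none. Its price is an additional term
  \<open>B * g * deriv g\<close> and coefficients as large as \<open>exp (2 * s)\<close>; this is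
  why the estimates carry an exponent \<open>p\<close> and ask for a rate \<open>K\<close> above
  \<open>p\<close>. With a genuine period neither occurs, so \<open>p = 0\<close>: growth is
  polynomial in \<open>Re s\<close>, and the periodic remainder is a polynomial, hence
  constant.\<close>

subsection \<open>A Wiman-Valiron estimate for periodic functions\<close>

text \<open>Schwarz's lemma, applied to a Moebius transform of \<open>w t * exp (- t)\<close>, gives \<open>w \<approx> exp\<close>.\<close>
lemma near_exp_derivs:
  fixes w :: "complex \<Rightarrow> complex"
  assumes holo: "w holomorphic_on ball 0 1" and w0: "w 0 = 1" and eta: "0 < \<eta>"
    and bound: "\<And>t. norm t < 1 \<Longrightarrow> norm (w t) \<le> (1 + \<eta>) * exp (Re t)"
  shows "norm ((deriv ^^ n) w 0 - 1) \<le> fact n * 2 ^ n * (8 * \<eta>)"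
proof -
  \<comment> \<open>Slightly smaller than \<open>1 / (1 + \<eta>)\<close>, so that \<open>H\<close>
    maps the disc strictly into itself, while \<open>1 - a\<close> is still of order
    \<open>\<eta>\<close>. Note that \<open>H 0 = a\<close>.\<close>
  define a where "a = 1 / (1 + 2 * \<eta>)"
  have a: "0 < a" "a < 1" using eta by (auto simp: a_def)
  define H where "H t = of_real a * w t * exp (- t)" for t
  have H_lt: "norm (H t) < 1" if "norm t < 1" for t
  proof -
    have "norm (H t) = a * norm (w t) * exp (- Re t)"
      using a by (simp add: H_def norm_mult)
    also have "\<dots> \<le> a * ((1 + \<eta>) * exp (Re t)) * exp (- Re t)"
      using bound[OF that] a by (intro mult_right_mono mult_left_mono) auto
    also have "\<dots> = a * (1 + \<eta>)" by (simp add: exp_minus field_simps)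
    also have "\<dots> < 1" using eta by (simp add: a_def field_simps)
    finally show ?thesis .
  qed
  have holH: "H holomorphic_on ball 0 1"
    unfolding H_def by (intro holomorphic_intros holo)
  \<comment> \<open>The disc automorphism sending \<open>a = H 0\<close> to 0, composed with
    \<open>H\<close>.\<close>
  define \<Phi> where "\<Phi> t = (H t - of_real a) / (1 - of_real a * H t)" for t
  have den: "1 - of_real a * H t \<noteq> 0" if "norm t < 1" for t
  proof
    assume "1 - of_real a * H t = 0"
    hence "norm (of_real a * H t) = 1" by (metis eq_iff_diff_eq_0 norm_one)
    moreover have "norm (of_real a * H t) < 1"
      using a H_lt[OF that] by (simp add: norm_mult) (smt (verit) mult_less_cancel_left2 norm_ge_zero mult_le_cancel_left2)
    ultimately show False by simp
  qed
  have Phi_lt: "norm (\<Phi> t) < 1" if "norm t < 1" for t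
  proof -
    define x y where "x = Re (H t)" and "y = Im (H t)"
    have xy: "x\<^sup>2 + y\<^sup>2 < 1"
      using H_lt[OF that] by (simp add: x_def y_def cmod_def)
    have "(norm (H t - of_real a))\<^sup>2 = (x - a)\<^sup>2 + y\<^sup>2"
      by (simp add: cmod_power2 x_def y_def)
    moreover have "(norm (1 - of_real a * H t))\<^sup>2 = (1 - a * x)\<^sup>2 + (a * y)\<^sup>2"
      by (simp add: cmod_power2 x_def y_def)
    moreover have "(1 - a * x)\<^sup>2 + (a * y)\<^sup>2 - ((x - a)\<^sup>2 + y\<^sup>2) = (1 - a\<^sup>2) * (1 - (x\<^sup>2 + y\<^sup>2))"
      by (simp add: power2_eq_square algebra_simps)
    moreover have "(1 - a\<^sup>2) * (1 - (x\<^sup>2 + y\<^sup>2)) > 0"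
      using xy a by (intro mult_pos_pos) (auto simp: abs_square_less_1)
    ultimately have "(norm (H t - of_real a))\<^sup>2 < (norm (1 - of_real a * H t))\<^sup>2" by linarith
    hence "norm (H t - of_real a) < norm (1 - of_real a * H t)"
      by (rule power2_less_imp_less) auto
    thus ?thesis using den[OF that] by (simp add: \<Phi>_def norm_divide)
  qed
  have "\<Phi> holomorphic_on ball 0 1"
    unfolding \<Phi>_def using den by (intro holomorphic_intros holH) auto
  moreover have "\<Phi> 0 = 0" by (simp add: \<Phi>_def H_def w0)
  ultimately have Phi_le: "norm (\<Phi> t) \<le> norm t" if "norm t < 1" for t
    using Schwarz_Lemma(1)[of \<Phi> t] Phi_lt that by auto
  have close: "norm (w t - exp t) \<le> 8 * \<eta>" if t: "norm t \<le> 1/2" for t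
  proof -
    have t1: "norm t < 1" using t by simp
    define q where "q = norm (H t - of_real a)"
    \<comment> \<open>Schwarz bounds \<open>q\<close> by half of \<open>norm (1 - a * H t)\<close>.
      Since that number is \<open>(1 - a\<^sup>2) - a * (H t - a)\<close>, the part containing
      \<open>q\<close> is absorbed on the left and only \<open>1 - a\<^sup>2\<close>, of order
      \<open>\<eta>\<close>, remains.\<close>
    have "q = norm (\<Phi> t) * norm (1 - of_real a * H t)"
      using den[OF t1] by (simp add: q_def \<Phi>_def norm_divide)
    also have "\<dots> \<le> 1/2 * norm (1 - of_real a * H t)"
      using Phi_le[OF t1] t by (intro mult_right_mono) auto
    also have "1 - of_real a * H t = of_real (1 - a\<^sup>2) - of_real a * (H t - of_real a)"
      by (simp add: power2_eq_square algebra_simps)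
    also have "norm \<dots> \<le> norm (of_real (1 - a\<^sup>2) :: complex) + norm (of_real a * (H t - of_real a))"
      by (rule norm_triangle_ineq4)
    also have "\<dots> = (1 - a\<^sup>2) + a * q"
      using a by (simp only: norm_of_real norm_mult q_def) (simp add: abs_if power2_eq_square, smt (verit) mult_le_one)
    finally have "q \<le> 1/2 * ((1 - a\<^sup>2) + a * q)" by simp
    moreover have "a * q \<le> q" using a by (simp add: q_def mult_left_le_one_le)
    ultimately have q: "q \<le> 1 - a\<^sup>2" by simp
    have "w t - exp t = exp t * ((H t - of_real a) / of_real a)"
      using a by (simp add: H_def exp_minus field_simps)
    hence "norm (w t - exp t) = exp (Re t) * (q / a)"
      using a by (simp add: norm_mult norm_divide q_def)
    also have "\<dots> \<le> 2 * (4 * \<eta>)"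
    proof (rule mult_mono)
      have "exp (Re t) \<le> exp (1/2)" using t complex_Re_le_cmod[of t] by simp
      also have "\<dots> \<le> (2::real)" using exp_bound_half[of "1/2::real"] by simp
      finally show "exp (Re t) \<le> 2" .
      have "q / a \<le> (1 - a\<^sup>2) / a" using q a by (intro divide_right_mono) auto
      also have "\<dots> = 1 / a - a" using a by (simp add: field_simps power2_eq_square)
      also have "\<dots> \<le> 4 * \<eta>"
      proof -
        have "1 - 2 * \<eta> \<le> a" unfolding a_def using eta by (simp add: field_simps)
        thus ?thesis by (simp add: a_def)
      qed
      finally show "q / a \<le> 4 * \<eta>" .
      show "0 \<le> q / a" using a by (simp add: q_def)
    qed auto
    finally show ?thesis by simp
  qed
  have hol2: "w holomorphic_on cball 0 (1/2)" 
    by (rule holomorphic_on_subset[OF holo]) auto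
  \<comment> \<open>Cauchy's estimate on the circle of radius 1/2 produces the factor
    \<open>2 ^ n\<close>.\<close>
  have "norm ((deriv ^^ n) (\<lambda>t. w t - exp t) 0) \<le> fact n * (8 * \<eta>) / (1/2) ^ n"
  proof (rule Cauchy_inequality)
    show "(\<lambda>t. w t - exp t) holomorphic_on ball 0 (1/2)"
      using hol2 by (intro holomorphic_intros) (auto elim: holomorphic_on_subset)
    show "continuous_on (cball 0 (1/2)) (\<lambda>t. w t - exp t)"
      by (intro continuous_intros holomorphic_on_imp_continuous_on hol2)
  qed (use close in auto)
  moreover have "(deriv ^^ n) (\<lambda>t. w t - exp t) 0 = (deriv ^^ n) w 0 - (deriv ^^ n) exp 0"
    by (rule higher_deriv_diff[where S = "ball 0 1"]) (use holo in \<open>auto intro!: holomorphic_intros\<close>)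
  moreover have "(deriv ^^ n) exp (0::complex) = 1"
    by (induction n) (simp_all add: DERIV_imp_deriv[OF DERIV_exp] funpow_Suc_right ext[of "deriv exp" "exp :: complex \<Rightarrow> complex"] del: funpow.simps)
  ultimately show ?thesis by (simp add: power_divide field_simps)
qed

lemma periodic_of_int:
  fixes g :: "complex \<Rightarrow> complex"
  assumes per: "\<And>s. Re s > 0 \<Longrightarrow> g (s + 2 * pi * \<i>) = g s" and s: "Re s > 0"
  shows "g (s + of_int k * (2 * pi * \<i>)) = g s"
proof (induction k rule: int_induct[where k = 0])
  case (step1 i)
  have "g (s + of_int (i + 1) * (2 * pi * \<i>)) = g ((s + of_int i * (2 * pi * \<i>)) + 2 * pi * \<i>)"
    by (simp add: algebra_simps)
  also have "\<dots> = g (s + of_int i * (2 * pi * \<i>))"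
    using s by (intro per) simp
  finally show ?case using step1 by simp
next
  case (step2 i)
  have "g ((s + of_int (i - 1) * (2 * pi * \<i>)) + 2 * pi * \<i>) = g (s + of_int (i - 1) * (2 * pi * \<i>))"
    using s by (intro per) simp
  thus ?case using step2 by (simp add: algebra_simps)
qed simp

text \<open>Reduces a supremum over an unbounded vertical strip to one over a compact rectangle,
  where it is attained.\<close>

lemma periodic_representative:
  fixes g :: "complex \<Rightarrow> complex"
  assumes per: "\<And>s. Re s > 0 \<Longrightarrow> g (s + 2 * pi * \<i>) = g s" and s: "Re s > 0"
  obtains s' where "Re s' = Re s" "0 \<le> Im s'" "Im s' \<le> 2 * pi" "g s' = g s"
proof
  define k where "k = \<lfloor>Im s / (2 * pi)\<rfloor>"
  define s' where "s' = s + of_int (- k) * (2 * pi * \<i>)"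
  show "g s' = g s" unfolding s'_def by (rule periodic_of_int[of g, OF per s])
  show "Re s' = Re s" by (simp add: s'_def)
  have im: "Im s' = Im s - of_int k * (2 * pi)" by (simp add: s'_def)
  have "of_int k * (2 * pi) \<le> Im s"
    using of_int_floor_le[of "Im s / (2 * pi)"] by (simp add: k_def[symmetric] pos_le_divide_eq)
  thus "0 \<le> Im s'" using im by simp
  have "Im s \<le> (of_int k + 1) * (2 * pi)"
    using real_of_int_floor_add_one_ge[of "Im s / (2 * pi)"] by (simp add: k_def[symmetric] pos_divide_le_eq)
  thus "Im s' \<le> 2 * pi" using im by (simp add: algebra_simps)
qed

text \<open>The logarithm of the left side exceeds its linear part by at most a quadratic term. This
  controls the factor of the weight that vanishes at the right end of the strip.\<close>

lemma one_div_one_minus_le: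
  fixes y :: real
  assumes "\<bar>y\<bar> \<le> 1/2"
  shows "1 / (1 - y) \<le> exp (y + 2 * y\<^sup>2)"
proof -
  have "\<bar>ln (1 + - y) - - y\<bar> \<le> 2 * (- y)\<^sup>2"
    by (rule abs_ln_one_plus_x_minus_x_bound) (use assms in auto)
  hence "- (y + 2 * y\<^sup>2) \<le> ln (1 - y)" by simp
  hence "exp (- (y + 2 * y\<^sup>2)) \<le> 1 - y"
    using assms by (subst (asm) ln_ge_iff) auto
  hence "1 / (1 - y) \<le> 1 / exp (- (y + 2 * y\<^sup>2))"
    by (intro divide_left_mono mult_pos_pos) (use assms in auto)
  thus ?thesis unfolding exp_minus inverse_eq_divide by simp
qed

text \<open>
  The point \<open>s\<close> maximises \<open>norm (g s) * W (Re s)\<close> for the weight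
  \<open>W x = exp (- p * x) * ((\<tau> + 1 - x) / x) ^ T\<close> on a strip, and \<open>K\<close> is the logarithmic derivative of
  \<open>1 / W\<close> at \<open>Re s\<close>. As \<open>W\<close> vanishes at \<open>\<tau> + 1\<close>, the maximum is interior, and the second logarithmic
  derivative of \<open>1 / W\<close> is at most of order \<open>K\<^sup>2 / T\<close>; hence \<open>g (s + t / K) / g s\<close> is bounded by almost
  \<open>exp (Re t)\<close> for \<open>norm t < 1\<close>.
\<close>
lemma wiman_valiron_point:
  fixes g :: "complex \<Rightarrow> complex"
  assumes holo: "g holomorphic_on {s. Re s > 0}"
    and per: "\<And>s. Re s > 0 \<Longrightarrow> g (s + 2 * pi * \<i>) = g s"
    and p: "p \<ge> 0" and N: "N \<ge> 0" and eps: "\<epsilon> > 0"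
    and big: "\<And>C (n::nat). \<exists>s. Re s \<ge> 1 \<and> norm (g s) > C * exp (p * Re s) * Re s ^ n"
  obtains s K where "Re s > 1" "K > p" "g s \<noteq> 0"
    "\<And>j. j \<le> 3 \<Longrightarrow> norm ((deriv ^^ j) g s - of_real K ^ j * g s) \<le> \<epsilon> * K ^ j * norm (g s)"
    "norm (g s) \<ge> N * exp (p * Re s) * (K\<^sup>2 + 1 / K\<^sup>2)"
proof -
  have cont: "continuous_on {s. Re s > 0} g" using holo by (rule holomorphic_on_imp_continuous_on)
  \<comment> \<open>\<open>384 = fact 3 * 2 ^ 3 * 8\<close> is the constant of
    \<open>near_exp_derivs\<close> for the third derivative, the highest one needed.\<close>
  define \<eta> where "\<eta> = \<epsilon> / 384"
  have eta: "\<eta> > 0" using eps by (simp add: \<eta>_def)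
  \<comment> \<open>The second-order error in the logarithm of the weight will be at most
    \<open>2 / T\<close>; with this choice it costs no more than a factor
    \<open>1 + \<eta>\<close>.\<close>
  have "\<exists>T::nat. T > 2 / ln (1 + \<eta>)" by (rule reals_Archimedean2)
  then obtain T0 :: nat where T0: "T0 > 2 / ln (1 + \<eta>)" by blast
  define T where "T = max T0 2"
  have T2: "T \<ge> 2" by (simp add: T_def)
  have Teta: "exp (2 / real T) \<le> 1 + \<eta>"
  proof -
    have "2 / ln (1 + \<eta>) < real T" using T0 by (simp add: T_def)
    hence "2 / real T \<le> ln (1 + \<eta>)" using eta T2 by (simp add: field_simps)
    thus ?thesis using eta by (subst ln_ge_iff[symmetric]) auto
  qed
  have strip: "compact (cbox (Complex 1 0) (Complex r (2 * pi)))" for r by (rule compact_cbox)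
  have "bounded (g ` cbox (Complex 1 0) (Complex 2 (2 * pi)))"
    by (intro compact_imp_bounded compact_continuous_image strip continuous_on_subset[OF cont])
       (auto simp: in_cbox_complex_iff)
  then obtain M1 where M1: "M1 > 0" and M1': "\<And>s. s \<in> cbox (Complex 1 0) (Complex 2 (2 * pi)) \<Longrightarrow> norm (g s) \<le> M1"
    unfolding bounded_pos by blast
  \<comment> \<open>The first summand yields the final lower bound for \<open>norm (g s)\<close>.
    The summand \<open>M1\<close> keeps the maximum away from \<open>Re s \<le> 2\<close>.\<close>
  define C1 where "C1 = N * ((p + 2 * T)\<^sup>2 + 1) + M1 + 1"
  have C1: "C1 \<ge> N * ((p + 2 * T)\<^sup>2 + 1)" "C1 > M1" "C1 > 0"
    using M1 N by (auto simp: C1_def intro: add_nonneg_pos)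
  \<comment> \<open>Of the \<open>2 * T + 2\<close> powers of \<open>Re s1\<close>, \<open>T\<close>
    compensate the weight at \<open>Re s1\<close> and the other \<open>T + 2\<close> give
    \<open>(\<tau> + 1) ^ (T + 2)\<close>; the factor \<open>2 ^ (T + 2)\<close> pays for
    \<open>\<tau> + 1 \<le> 2 * \<tau>\<close>.\<close>
  obtain s1 where s1: "Re s1 \<ge> 1" 
    and s1': "norm (g s1) > C1 * 2 ^ (T + 2) * exp (p * Re s1) * Re s1 ^ (2 * T + 2)"
    using big[of "C1 * 2 ^ (T + 2)" "2 * T + 2"] by blast
  define \<tau> where "\<tau> = Re s1"
  have tau: "\<tau> \<ge> 1" using s1 by (simp add: \<tau>_def)
  define W where "W x = exp (- p * x) * ((\<tau> + 1 - x) / x) ^ T" for x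
  define X where "X = norm (g s1) * W \<tau>"
  have X: "X > C1 * (\<tau> + 1) ^ (T + 2)"
  proof -
    have "C1 * (\<tau> + 1) ^ (T + 2) \<le> C1 * (2 * \<tau>) ^ (T + 2)"
      using C1 tau by (intro mult_left_mono power_mono) auto
    also have "\<dots> = (C1 * 2 ^ (T + 2) * exp (p * \<tau>) * \<tau> ^ (2 * T + 2)) * W \<tau>"
    proof -
      have Wt: "W \<tau> = exp (- p * \<tau>) * (1 / \<tau>) ^ T" by (simp add: W_def)
      have e: "\<tau> ^ (2 * T + 2) = \<tau> ^ (T + 2) * \<tau> ^ T" by (simp add: mult_2 flip: power_add)
      have "(C1 * 2 ^ (T + 2) * exp (p * \<tau>) * \<tau> ^ (2 * T + 2)) * W \<tau>
          = (C1 * (2 ^ (T + 2) * \<tau> ^ (T + 2))) * (exp (p * \<tau>) * exp (- p * \<tau>)) * (\<tau> ^ T * (1 / \<tau>) ^ T)"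
        unfolding e Wt by (simp only: mult_ac)
      also have "\<dots> = C1 * (2 ^ (T + 2) * \<tau> ^ (T + 2))"
        using tau by (simp add: power_divide flip: exp_add)
      finally show ?thesis by (simp only: power_mult_distrib)
    qed
    also have "\<dots> < X"
      unfolding X_def using s1' tau by (intro mult_strict_right_mono) (auto simp: \<tau>_def W_def)
    finally show ?thesis .
  qed
  have Xpos: "X > 0" 
  proof -
    have "0 < C1 * (\<tau> + 1) ^ (T + 2)" using C1 tau by simp
    thus ?thesis using X by linarith
  qed
  have ex: "\<exists>s0\<in>cbox (Complex 1 0) (Complex (\<tau> + 1) (2 * pi)). \<forall>s\<in>cbox (Complex 1 0) (Complex (\<tau> + 1) (2 * pi)).
           norm (g s) * W (Re s) \<le> norm (g s0) * W (Re s0)"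
  proof (rule continuous_attains_sup[OF strip])
    show "cbox (Complex 1 0) (Complex (\<tau> + 1) (2 * pi)) \<noteq> {}"
      using tau by (auto simp: box_ne_empty Basis_complex_def)
    show "continuous_on (cbox (Complex 1 0) (Complex (\<tau> + 1) (2 * pi))) (\<lambda>s. norm (g s) * W (Re s))"
      unfolding W_def by (intro continuous_intros continuous_on_subset[OF cont]) (auto simp: in_cbox_complex_iff)
  qed
  then obtain s0 where s0: "s0 \<in> cbox (Complex 1 0) (Complex (\<tau> + 1) (2 * pi))"
    and max0: "\<And>s. s \<in> cbox (Complex 1 0) (Complex (\<tau> + 1) (2 * pi)) \<Longrightarrow> norm (g s) * W (Re s) \<le> norm (g s0) * W (Re s0)"
    by blast
  have max: "norm (g s) * W (Re s) \<le> norm (g s0) * W (Re s0)" if "1 \<le> Re s" "Re s \<le> \<tau> + 1" for s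
  proof -
    have "Re s > 0" using that by simp
    from periodic_representative[of g, OF per this]
    obtain s' where "Re s' = Re s" "0 \<le> Im s'" "Im s' \<le> 2 * pi" "g s' = g s" by blast
    thus ?thesis using max0[of s'] that by (simp add: in_cbox_complex_iff)
  qed
  define \<sigma> where "\<sigma> = Re s0"
  define d where "d = \<tau> + 1 - \<sigma>"
  have sig: "1 \<le> \<sigma>" "\<sigma> \<le> \<tau> + 1" using s0 by (auto simp: \<sigma>_def in_cbox_complex_iff)
  have maxX: "X \<le> norm (g s0) * W \<sigma>"
    using max[of s1] tau by (simp add: X_def \<sigma>_def \<tau>_def)
  have d: "0 < d"
  proof (rule ccontr)
    assume "\<not> 0 < d"
    hence "\<sigma> = \<tau> + 1" using sig by (simp add: d_def)
    thus False using maxX Xpos T2 by (simp add: W_def power_0_left)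
  qed
  have d_le: "d \<le> \<tau>" using sig by (simp add: d_def)
  have g0: "g s0 \<noteq> 0" using maxX Xpos by auto
  have Wpos: "W x > 0" if "1 \<le> x" "x < \<tau> + 1" for x using that by (auto simp: W_def)
  \<comment> \<open>For real parts between 1 and 2 the modulus is at most \<open>M1 < C1\<close> and
    the weight at most \<open>(\<tau> + 1) ^ T\<close>, which is too small for a maximum of at least
    \<open>X\<close>. Being beyond 2 leaves room for a disc around \<open>s0\<close> inside the
    strip.\<close>
  have sig2: "\<sigma> > 2"
  proof (rule ccontr)
    assume "\<not> \<sigma> > 2"
    hence "norm (g s0) \<le> M1" using s0 by (intro M1') (auto simp: in_cbox_complex_iff \<sigma>_def)
    moreover have "W \<sigma> \<le> 1 * (\<tau> + 1) ^ T"
    proof -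
      have "(\<tau> + 1 - \<sigma>) / \<sigma> \<le> (\<tau> + 1) / 1"
        using sig by (intro frac_le) auto
      thus ?thesis unfolding W_def using sig p
        by (intro mult_mono power_mono) auto
    qed
    moreover have "W \<sigma> \<ge> 0" using Wpos[of \<sigma>] sig d by (simp add: d_def)
    ultimately have "X \<le> M1 * (1 * (\<tau> + 1) ^ T)" 
      using M1 by (intro order_trans[OF maxX] mult_mono) auto
    also have "\<dots> \<le> C1 * (\<tau> + 1) ^ (T + 2)"
      using C1 tau M1 power_increasing[of T "T + 2" "\<tau> + 1"]
      by (intro mult_mono) (simp_all del: power_add_numeral2 power_add_numeral add_2_eq_Suc')
    finally show False using X by simp
  qed
  \<comment> \<open>Minus the logarithmic derivative of \<open>W\<close> at \<open>\<sigma>\<close>,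
    with one summand for each of its three factors.\<close>
  define K where "K = p + T / \<sigma> + T / d"
  have K: "K > p" "K > 0" "K \<ge> T / \<sigma>" "K \<ge> T / d" using p sig d T2 by (auto simp: K_def intro!: add_nonneg_pos)
  have invK: "1 / K \<le> \<sigma> / T" "1 / K \<le> d / T"
    using K sig d T2 by (auto simp: field_simps)
  define w where "w t = g (of_real (1 / K) * t + s0) / g s0" for t
  \<comment> \<open>The natural scale \<open>1 / K\<close> is at most \<open>\<sigma> / T\<close>
    and at most \<open>d / T\<close>, so the disc of this radius reaches neither end of the
    strip.\<close>
  have in_strip: "1 \<le> \<sigma> + Re t / K \<and> \<sigma> + Re t / K < \<tau> + 1 \<and> \<bar>Re t / K\<bar> \<le> d / T" if "norm t < 1" for t
  proof -
    have "\<bar>Re t\<bar> < 1" using that abs_Re_le_cmod[of t] by simp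
    hence "\<bar>Re t / K\<bar> < 1 / K" using K by (simp add: divide_strict_right_mono)
    moreover define x where "x = Re t / K"
    ultimately have *: "\<bar>x\<bar> < \<sigma> / T" "\<bar>x\<bar> < d / T" using invK by auto
    have "\<sigma> / T \<le> \<sigma> / 2" "d / T \<le> d" using T2 sig d by (auto simp: field_simps)
    hence "1 \<le> \<sigma> + x" "x < d" "\<bar>x\<bar> \<le> d / T" using * sig2 by linarith+
    thus ?thesis unfolding x_def[symmetric] by (simp add: d_def)
  qed
  have holw: "w holomorphic_on ball 0 1"
  proof -
    have "(g \<circ> (\<lambda>t. of_real (1 / K) * t + s0)) holomorphic_on ball 0 1"
    proof (rule holomorphic_on_compose_gen[OF _ holo])
      show "(\<lambda>t. of_real (1 / K) * t + s0) ` ball 0 1 \<subseteq> {s. Re s > 0}"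
        using in_strip by (force simp: \<sigma>_def add.commute)
    qed (intro holomorphic_intros)
    thus ?thesis unfolding w_def o_def using g0 by (intro holomorphic_intros) auto
  qed
  have wbound: "norm (w t) \<le> (1 + \<eta>) * exp (Re t)" if t: "norm t < 1" for t
  proof -
    define x where "x = Re t / K"
    define y where "y = x / d"
    have x: "1 \<le> \<sigma> + x" "\<sigma> + x < \<tau> + 1" "\<bar>x\<bar> \<le> d / T" using in_strip[OF t] by (auto simp: x_def)
    have y: "\<bar>y\<bar> \<le> 1 / T" using x d T2 by (auto simp: y_def abs_div field_simps)
    have y': "\<bar>y\<bar> \<le> 1/2" using order_trans[OF y, of "1/2"] T2 by (simp add: field_simps)
    have "norm (g (of_real (1 / K) * t + s0)) * W (\<sigma> + x) \<le> norm (g s0) * W \<sigma>"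
      using max[of "of_real (1 / K) * t + s0"] x by (simp add: \<sigma>_def x_def add.commute)
    hence "norm (w t) \<le> W \<sigma> / W (\<sigma> + x)"
      using Wpos[of "\<sigma> + x"] x g0 by (simp add: w_def norm_divide field_simps)
    also have "\<dots> = exp (p * x) * ((1 + x / \<sigma>) * (1 / (1 - y))) ^ T"
    proof -
      have "(d / \<sigma>) = ((1 + x / \<sigma>) * (1 / (1 - y))) * ((\<tau> + 1 - (\<sigma> + x)) / (\<sigma> + x))"
      proof -
        have "\<tau> + 1 - (\<sigma> + x) = d * (1 - y)" using d by (simp add: d_def y_def field_simps)
        moreover have "\<sigma> + x = \<sigma> * (1 + x / \<sigma>)" using sig by (simp add: field_simps)
        moreover have "1 - y \<noteq> 0" "1 + x / \<sigma> \<noteq> 0" "\<sigma> \<noteq> 0" using y' x sig2 by (auto simp: field_simps)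
        ultimately show ?thesis by simp
      qed
      hence "(d / \<sigma>) ^ T = ((1 + x / \<sigma>) * (1 / (1 - y))) ^ T * ((\<tau> + 1 - (\<sigma> + x)) / (\<sigma> + x)) ^ T"
        by (metis power_mult_distrib)
      moreover have "exp (- p * \<sigma>) = exp (p * x) * exp (- p * (\<sigma> + x))"
        by (simp flip: exp_add add: algebra_simps)
      ultimately have "W \<sigma> = exp (p * x) * ((1 + x / \<sigma>) * (1 / (1 - y))) ^ T * W (\<sigma> + x)"
        by (simp add: W_def d_def mult_ac)
      thus ?thesis using Wpos[of "\<sigma> + x"] x by simp
    qed
    also have "\<dots> \<le> exp (p * x) * (exp (x / \<sigma>) * exp (y + 2 * y\<^sup>2)) ^ T"
    proof (intro mult_left_mono power_mono mult_mono)
      show "1 + x / \<sigma> \<le> exp (x / \<sigma>)" by (rule exp_ge_add_one_self)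
      show "1 / (1 - y) \<le> exp (y + 2 * y\<^sup>2)" by (rule one_div_one_minus_le[OF y'])
      show "0 \<le> (1 + x / \<sigma>) * (1 / (1 - y))" using y' x sig2 by (intro mult_nonneg_nonneg) (auto simp: field_simps)
    qed (use y' in auto)
    also have "\<dots> = exp (p * x + T * (x / \<sigma>) + T * y + 2 * (T * y\<^sup>2))"
      by (simp add: exp_of_nat_mult[symmetric] power_mult_distrib flip: exp_add) (simp add: algebra_simps)
    \<comment> \<open>By the choice of \<open>K\<close> the linear terms add up to exactly
      \<open>K * x = Re t\<close>; the remainder \<open>2 * T * y\<^sup>2\<close> is at most
      \<open>2 / T\<close> because \<open>\<bar>y\<bar> \<le> 1 / T\<close>.\<close>
    also have "\<dots> \<le> exp (Re t + 2 / T)"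
    proof -
      have "p * x + T * (x / \<sigma>) + T * y = K * x" by (simp add: K_def y_def algebra_simps)
      hence "p * x + T * (x / \<sigma>) + T * y = Re t" using K by (simp add: x_def)
      moreover have "T * y\<^sup>2 \<le> 1 / T"
      proof -
        have "T * y\<^sup>2 \<le> T * (1 / T)\<^sup>2" 
          using y by (intro mult_left_mono) (auto simp: abs_le_square_iff[symmetric])
        thus ?thesis using T2 by (simp add: power2_eq_square)
      qed
      ultimately show ?thesis by simp
    qed
    also have "\<dots> = exp (2 / T) * exp (Re t)" by (simp add: exp_add)
    also have "\<dots> \<le> (1 + \<eta>) * exp (Re t)" using Teta by (intro mult_right_mono) auto
    finally show ?thesis .
  qed
  show ?thesis
  proof (rule that[of s0 K])
    show "Re s0 > 1" using sig2 by (simp add: \<sigma>_def)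
    show "K > p" "g s0 \<noteq> 0" by fact+
    fix j :: nat assume j: "j \<le> 3"
    have est: "norm ((deriv ^^ j) w 0 - 1) \<le> fact j * 2 ^ j * (8 * \<eta>)"
      by (rule near_exp_derivs[OF holw _ eta wbound]) (simp_all add: w_def g0)
    have "fact j * 2 ^ j * (8 * \<eta>) \<le> fact 3 * 2 ^ 3 * (8 * \<eta>)"
      using j eta by (intro mult_right_mono mult_mono fact_mono power_increasing) auto
    also have "\<dots> = \<epsilon>" by (simp add: \<eta>_def fact_numeral)
    finally have est': "norm ((deriv ^^ j) w 0 - 1) \<le> \<epsilon>" using est by linarith
    have "(deriv ^^ j) w 0 = (deriv ^^ j) (\<lambda>t. g (of_real (1 / K) * t + s0)) 0 / g s0"
    proof -
      have "(\<lambda>t. g (of_real (1 / K) * t + s0)) holomorphic_on ball 0 1"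
      proof -
        have "(\<lambda>t. w t * g s0) holomorphic_on ball 0 1" by (intro holomorphic_intros holw)
        thus ?thesis using g0 by (simp add: w_def)
      qed
      hence "(deriv ^^ j) (\<lambda>t. inverse (g s0) * g (of_real (1 / K) * t + s0)) 0 = inverse (g s0) * (deriv ^^ j) (\<lambda>t. g (of_real (1 / K) * t + s0)) 0"
        by (intro higher_deriv_cmult[where A = "ball 0 1"]) auto
      thus ?thesis unfolding w_def by (simp add: field_simps)
    qed
    also have "(deriv ^^ j) (\<lambda>t. g (of_real (1 / K) * t + s0)) 0 = of_real (1 / K) ^ j * (deriv ^^ j) g (of_real (1 / K) * 0 + s0)"
    proof (rule higher_deriv_compose_linear'[where S = "ball 0 1", OF holo])
      show "open {s. Re s > 0}" by (rule open_halfspace_Re_gt)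
      show "of_real (1 / K) * t + s0 \<in> {s. Re s > 0}" if "t \<in> ball 0 1" for t
        using in_strip[of t] that by (auto simp: \<sigma>_def add.commute)
    qed auto
    finally have "(deriv ^^ j) w 0 = (deriv ^^ j) g s0 / (of_real K ^ j * g s0)"
      by (simp add: power_divide)
    hence "(deriv ^^ j) g s0 - of_real K ^ j * g s0 = of_real K ^ j * g s0 * ((deriv ^^ j) w 0 - 1)"
      using g0 K by (simp add: field_simps)
    hence "norm ((deriv ^^ j) g s0 - of_real K ^ j * g s0) = K ^ j * norm (g s0) * norm ((deriv ^^ j) w 0 - 1)"
      using K by (simp add: norm_mult norm_power)
    also have "\<dots> \<le> K ^ j * norm (g s0) * \<epsilon>"
      using est' K by (intro mult_left_mono) auto
    finally show "norm ((deriv ^^ j) g s0 - of_real K ^ j * g s0) \<le> \<epsilon> * K ^ j * norm (g s0)"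
      by (simp add: mult_ac)
  next
    \<comment> \<open>\<open>K\<close> can be large only if \<open>d\<close> is small, and then it
      is at most a constant times \<open>Y\<close>. The weight at \<open>\<sigma>\<close> contains
      \<open>d ^ T\<close>, so dividing by it yields \<open>Y ^ T\<close>, which dominates
      \<open>Y\<^sup>2\<close> as \<open>T \<ge> 2\<close>.\<close>
    define Y where "Y = (\<tau> + 1) / d"
    have Y1: "Y \<ge> 1" using d d_le by (simp add: Y_def)
    have "K \<le> (p + 2 * T) * Y"
    proof -
      have "T / \<sigma> \<le> T / 1" using sig by (intro divide_left_mono) auto
      hence "T / \<sigma> \<le> T" by simp
      moreover have "T / d \<le> T * Y" using tau d by (simp add: Y_def field_simps)
      moreover have "p + T \<le> (p + T) * Y" using Y1 p by (simp add: mult_le_cancel_left1)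
      ultimately show ?thesis unfolding K_def by (simp add: algebra_simps)
    qed
    hence KY: "K\<^sup>2 \<le> (p + 2 * T)\<^sup>2 * Y\<^sup>2" using power_mono[of K "(p + 2 * T) * Y" 2] K by (simp add: power_mult_distrib)
    have "1 / K \<le> \<tau> + 1"
    proof -
      have "\<sigma> / T \<le> \<sigma> / 1" using T2 sig by (intro divide_left_mono) auto
      thus ?thesis using invK sig by linarith
    qed
    hence KI: "1 / K\<^sup>2 \<le> (\<tau> + 1)\<^sup>2" using power_mono[of "1 / K" "\<tau> + 1" 2] K by (simp add: power_one_over)
    have "K\<^sup>2 + 1 / K\<^sup>2 \<le> (p + 2 * T)\<^sup>2 * (Y\<^sup>2 * (\<tau> + 1)\<^sup>2) + Y\<^sup>2 * (\<tau> + 1)\<^sup>2"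
    proof (rule add_mono)
      have "Y\<^sup>2 \<le> Y\<^sup>2 * (\<tau> + 1)\<^sup>2" using tau by (simp add: mult_le_cancel_left1)
      thus "K\<^sup>2 \<le> (p + 2 * T)\<^sup>2 * (Y\<^sup>2 * (\<tau> + 1)\<^sup>2)"
        using KY by (intro order_trans[OF KY] mult_left_mono) auto
      have "(\<tau> + 1)\<^sup>2 \<le> Y\<^sup>2 * (\<tau> + 1)\<^sup>2" using Y1 by (simp add: mult_le_cancel_right1)
      thus "1 / K\<^sup>2 \<le> Y\<^sup>2 * (\<tau> + 1)\<^sup>2" using KI by simp
    qed
    also have "\<dots> = ((p + 2 * T)\<^sup>2 + 1) * ((\<tau> + 1)\<^sup>2 * Y\<^sup>2)" by (simp add: algebra_simps)
    also have "\<dots> \<le> ((p + 2 * T)\<^sup>2 + 1) * ((\<tau> + 1)\<^sup>2 * Y ^ T)"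
      using Y1 T2 by (intro mult_left_mono power_increasing) auto
    finally have "N * (K\<^sup>2 + 1 / K\<^sup>2) \<le> N * (((p + 2 * T)\<^sup>2 + 1) * ((\<tau> + 1)\<^sup>2 * Y ^ T))"
      using N by (rule mult_left_mono)
    also have "\<dots> \<le> C1 * ((\<tau> + 1)\<^sup>2 * Y ^ T)"
      using mult_right_mono[OF C1(1), of "(\<tau> + 1)\<^sup>2 * Y ^ T"] Y1 by (simp add: mult_ac)
    also have "\<dots> = C1 * (\<tau> + 1) ^ (T + 2) / d ^ T"
      by (simp add: Y_def power_divide power_add power2_eq_square)
    also have "\<dots> \<le> X / d ^ T" using X d by (intro divide_right_mono) auto
    also have "\<dots> \<le> norm (g s0) * W \<sigma> / d ^ T" using maxX d by (intro divide_right_mono) auto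
    also have "\<dots> = norm (g s0) * exp (- p * \<sigma>) / \<sigma> ^ T"
      using d by (simp add: W_def d_def[symmetric] power_divide)
    also have "\<dots> \<le> norm (g s0) * exp (- p * \<sigma>) / 1"
      using sig by (intro divide_left_mono) auto
    finally have "N * (K\<^sup>2 + 1 / K\<^sup>2) * exp (p * \<sigma>) \<le> norm (g s0) * exp (- p * \<sigma>) * exp (p * \<sigma>)"
      by (intro mult_right_mono) auto
    thus "N * exp (p * Re s0) * (K\<^sup>2 + 1 / K\<^sup>2) \<le> norm (g s0)"
      by (simp add: exp_minus \<sigma>_def mult_ac)
  qed
qed

subsection \<open>Growth of periodic solutions of quadratic equations\<close>

text \<open>At a point where each derivative of order j is close to \<open>K ^ j * g s\<close>, the
  left side is close to \<open>(A + B) * K\<^sup>2 * (g s)\<^sup>2\<close>. The term with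
  \<open>E\<close> takes up about half of this at most, because \<open>K > p\<close>. The linear
  terms take up an arbitrarily small fraction, because \<open>norm (g s)\<close> exceeds any
  prescribed multiple of \<open>exp (p * Re s) * (K\<^sup>2 + 1 / K\<^sup>2)\<close>.\<close>

lemma quadratic_ode_growth:
  fixes g :: "complex \<Rightarrow> complex" and A B E :: complex and C p :: real
  assumes holo: "g holomorphic_on {s. Re s > 0}"
    and per: "\<And>s. Re s > 0 \<Longrightarrow> g (s + 2 * pi * \<i>) = g s"
    and p: "p \<ge> 0" and AB: "A + B \<noteq> 0" and E: "norm E \<le> p * norm (A + B) / 2"
    and ode: "\<And>s. Re s > 0 \<Longrightarrow> A * (deriv g s)\<^sup>2 + B * g s * (deriv ^^ 2) g s = E * g s * deriv g s
        + c3 s * (deriv ^^ 3) g s + c2 s * (deriv ^^ 2) g s + c1 s * deriv g s + c0 s * g s + c s"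
    and coeffs: "\<And>s. Re s > 0 \<Longrightarrow> norm (c3 s) \<le> C * exp (p * Re s) \<and> norm (c2 s) \<le> C * exp (p * Re s)
        \<and> norm (c1 s) \<le> C * exp (p * Re s) \<and> norm (c0 s) \<le> C * exp (p * Re s) \<and> norm (c s) \<le> C * exp (p * Re s)"
  shows "\<exists>C' (n::nat). \<forall>s. Re s \<ge> 1 \<longrightarrow> norm (g s) \<le> C' * exp (p * Re s) * Re s ^ n"
proof (rule ccontr)
  assume "\<not> ?thesis"
  hence big: "\<exists>s. Re s \<ge> 1 \<and> norm (g s) > C' * exp (p * Re s) * Re s ^ n" for C' and n :: nat
    by (meson not_le)
  define m where "m = norm (A + B)"
  have m: "m > 0" using AB by (simp add: m_def)
  have C: "C \<ge> 0"
  proof -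
    have "0 \<le> C * exp (p * 1)"
      using coeffs[of 1] by (intro order_trans[OF norm_ge_zero[of "c 1"]]) auto
    thus ?thesis by (simp add: zero_le_mult_iff)
  qed
  \<comment> \<open>Collects the relative errors of the quadratic terms: \<open>3 * norm A\<close>
    from the square of the first derivative, \<open>norm B\<close> from the second derivative, and
    \<open>m / 2\<close> from the term with \<open>E\<close>.\<close>
  define M where "M = 3 * norm A + norm B + m / 2"
  have M: "M > 0" using m by (simp add: M_def add_nonneg_pos)
  define \<epsilon> where "\<epsilon> = min 1 (m / (8 * M))"
  have eps: "0 < \<epsilon>" "\<epsilon> \<le> 1" "\<epsilon> * M \<le> m / 8"
  proof -
    have "\<epsilon> * M \<le> m / (8 * M) * M" using M by (intro mult_right_mono) (auto simp: \<epsilon>_def)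
    thus "\<epsilon> * M \<le> m / 8" using M by simp
  qed (use m M in \<open>auto simp: \<epsilon>_def\<close>)
  \<comment> \<open>Chosen so that the linear terms, bounded by \<open>9 * C / N\<close> times the
    main term, cost at most \<open>m / 8\<close>. The final balance is then
    \<open>m \<le> m / 2 + m / 8 + m / 8\<close>, a contradiction.\<close>
  define N where "N = 1 + 72 * C / m"
  have N: "N \<ge> 1" "9 * C / N \<le> m / 8"
  proof -
    show N1: "N \<ge> 1" using C m by (simp add: N_def)
    have "72 * C \<le> m * N" using m by (simp add: N_def algebra_simps)
    thus "9 * C / N \<le> m / 8" using N1 by (simp add: field_simps)
  qed
  obtain s K where s: "Re s > 1" and Kp: "K > p" and g0: "g s \<noteq> 0"
    and der: "\<And>j. j \<le> 3 \<Longrightarrow> norm ((deriv ^^ j) g s - of_real K ^ j * g s) \<le> \<epsilon> * K ^ j * norm (g s)"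
    and large: "norm (g s) \<ge> N * exp (p * Re s) * (K\<^sup>2 + 1 / K\<^sup>2)"
    using wiman_valiron_point[OF holo per p _ eps(1) big, of N] N by auto
  have K: "K > 0" using Kp p by simp
  define G where "G = norm (g s)"
  define X where "X = exp (p * Re s)"
  define D1 D2 D3 where "D1 = deriv g s" and "D2 = (deriv ^^ 2) g s" and "D3 = (deriv ^^ 3) g s"
  have G: "G > 0" using g0 by (simp add: G_def)
  have X: "X \<ge> 1" using p s by (simp add: X_def)
  have d1: "norm (D1 - K * g s) \<le> \<epsilon> * K * G" using der[of 1] by (simp add: D1_def G_def)
  have d2: "norm (D2 - K\<^sup>2 * g s) \<le> \<epsilon> * K\<^sup>2 * G" using der[of 2] by (simp add: D2_def G_def)
  have d3: "norm (D3 - K ^ 3 * g s) \<le> \<epsilon> * K ^ 3 * G" using der[of 3] by (simp add: D3_def G_def)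
  have size: "norm D \<le> 2 * (K ^ j * G)" if "norm (D - of_real (K ^ j) * g s) \<le> \<epsilon> * K ^ j * G" for D and j :: nat
  proof -
    have "norm D \<le> norm (D - of_real (K ^ j) * g s) + norm (of_real (K ^ j) * g s)"
      using norm_triangle_ineq[of "D - of_real (K ^ j) * g s" "of_real (K ^ j) * g s"] by simp
    moreover have "norm (of_real (K ^ j) * g s) = K ^ j * G" using K by (simp only: norm_mult norm_of_real G_def) simp
    moreover have "\<epsilon> * K ^ j * G \<le> 1 * K ^ j * G" using eps K G by (intro mult_right_mono) auto
    ultimately show ?thesis using that by simp
  qed
  have n1: "norm D1 \<le> 2 * (K * G)" using size[of D1 1] d1 by simp
  have n2: "norm D2 \<le> 2 * (K\<^sup>2 * G)" using size[of D2 2] d2 by simp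
  have n3: "norm D3 \<le> 2 * (K ^ 3 * G)" using size[of D3 3] d3 by simp
  have n1': "norm D1 \<le> (1 + \<epsilon>) * (K * G)"
  proof -
    have "norm D1 \<le> norm (D1 - K * g s) + norm (K * g s)"
      using norm_triangle_ineq[of "D1 - K * g s" "K * g s"] by simp
    thus ?thesis using d1 K by (simp add: norm_mult G_def algebra_simps)
  qed
  define U where "U = K\<^sup>2 * G\<^sup>2"
  have U: "U > 0" using K G by (simp add: U_def)
  have sq: "norm (D1\<^sup>2 - (K * g s)\<^sup>2) \<le> 3 * \<epsilon> * U"
  proof -
    have "norm (D1 + K * g s) \<le> 3 * (K * G)"
      using norm_triangle_ineq[of D1 "K * g s"] n1 K by (simp add: norm_mult G_def)
    moreover have "D1\<^sup>2 - (K * g s)\<^sup>2 = (D1 - K * g s) * (D1 + K * g s)"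
      by (simp add: power2_eq_square algebra_simps)
    ultimately have "norm (D1\<^sup>2 - (K * g s)\<^sup>2) \<le> (\<epsilon> * K * G) * (3 * (K * G))"
      using d1 eps K G by (simp only: norm_mult) (intro mult_mono, auto)
    thus ?thesis by (simp add: U_def power2_eq_square mult_ac)
  qed
  have small: "2 * C * X * G * (K ^ 3 + K\<^sup>2 + K + 1) + C * X \<le> 9 * C / N * U"
  proof -
    define Q where "Q = K\<^sup>2 + 1 / K\<^sup>2"
    have Q: "Q > 0" using K by (simp add: Q_def add_pos_pos)
    have K2Q: "K\<^sup>2 * Q = K ^ 4 + 1" using K by (simp add: Q_def algebra_simps flip: power_add)
    \<comment> \<open>Since \<open>K ^ 4 + 1 = K\<^sup>2 * (K\<^sup>2 + 1 / K\<^sup>2)\<close>, the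
      weight \<open>K\<^sup>2 + 1 / K\<^sup>2\<close> covers all four powers at once, for large
      \<open>K\<close> by its first summand and for small \<open>K\<close> by its second.\<close>
    have pw: "K ^ 3 + K\<^sup>2 + K + 1 \<le> 4 * (K ^ 4 + 1)"
    proof -
      have "K ^ j \<le> K ^ 4 + 1" if "j \<le> 4" for j :: nat
      proof (cases "K \<ge> 1")
        case True
        thus ?thesis using power_increasing[OF that True] by simp
      next
        case False
        hence "K ^ j \<le> 1" using K by (intro power_le_one) auto
        moreover have "0 \<le> K ^ 4" using K by simp
        ultimately show ?thesis by linarith
      qed
      note le = this
      have "K \<le> K ^ 4 + 1" "K\<^sup>2 \<le> K ^ 4 + 1" "K ^ 3 \<le> K ^ 4 + 1" "0 \<le> K ^ 4"
        using le[of 1] le[of 2] le[of 3] K by simp_all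
      moreover have "a + b + c + 1 \<le> 4 * (d + 1)" if "c \<le> d + 1" "b \<le> d + 1" "a \<le> d + 1" "0 \<le> d" for a b c d :: real
        using that by argo
      ultimately show ?thesis by blast
    qed
    have Gl: "N * (X * Q) \<le> G" using large by (simp add: G_def X_def Q_def mult_ac)
    have XQ: "X * Q \<le> G / N" using Gl N by (simp add: field_simps)
    \<comment> \<open>This gives \<open>G \<ge> 1\<close>, so that the inhomogeneous term, which
      carries no factor \<open>G\<close>, can also be compared with
      \<open>G\<^sup>2\<close>.\<close>
    have "Q \<ge> 1"
    proof -
      have "0 \<le> (K - 1 / K)\<^sup>2" by simp
      thus ?thesis using K by (simp add: Q_def power2_diff power_one_over)
    qed
    hence "1 * (1 * 1) \<le> N * (X * Q)" using N X by (intro mult_mono) auto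
    hence G1: "1 \<le> G" using Gl by simp
    have XK: "X * (K ^ 4 + 1) \<le> K\<^sup>2 * G / N"
      using mult_left_mono[OF XQ, of "K\<^sup>2"] by (simp add: K2Q[symmetric] mult_ac)
    have "2 * C * X * G * (K ^ 3 + K\<^sup>2 + K + 1) \<le> 2 * C * X * G * (4 * (K ^ 4 + 1))"
      using pw C X G by (intro mult_left_mono) auto
    also have "\<dots> = 8 * C * G * (X * (K ^ 4 + 1))" by (simp add: mult_ac)
    also have "\<dots> \<le> 8 * C * G * (K\<^sup>2 * G / N)" using XK C G by (intro mult_left_mono) auto
    also have "\<dots> = 8 * C / N * U" by (simp add: U_def power2_eq_square)
    finally have 1: "2 * C * X * G * (K ^ 3 + K\<^sup>2 + K + 1) \<le> 8 * C / N * U" .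
    have "X \<le> X * (K ^ 4 + 1)" using X K by (simp add: mult_le_cancel_left1)
    also have "\<dots> \<le> K\<^sup>2 * G / N" by fact
    also have "\<dots> \<le> K\<^sup>2 * G / N * G" using mult_left_mono[OF G1, of "K\<^sup>2 * G / N"] G N by simp
    finally have "C * X \<le> C * (K\<^sup>2 * G / N * G)" using C by (intro mult_left_mono) auto
    also have "\<dots> = C / N * U" by (simp add: U_def power2_eq_square)
    finally have 2: "C * X \<le> C / N * U" .
    have "8 * C / N * U + C / N * U = 9 * C / N * U" using N by (simp add: field_simps)
    thus ?thesis using 1 2 by linarith
  qed
  define R where "R = c3 s * D3 + c2 s * D2 + c1 s * D1 + c0 s * g s + c s"
  have R: "norm R \<le> 9 * C / N * U"
  proof -
    have c: "norm (c3 s) \<le> C * X" "norm (c2 s) \<le> C * X" "norm (c1 s) \<le> C * X" "norm (c0 s) \<le> C * X" "norm (c s) \<le> C * X"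
      using coeffs[of s] s by (auto simp: X_def)
    have "norm R \<le> norm (c3 s) * norm D3 + norm (c2 s) * norm D2 + norm (c1 s) * norm D1 + norm (c0 s) * G + norm (c s)"
      unfolding R_def G_def by (intro norm_triangle_mono norm_mult_ineq order_refl)
    also have "\<dots> \<le> C * X * (2 * (K ^ 3 * G)) + C * X * (2 * (K\<^sup>2 * G)) + C * X * (2 * (K * G)) + C * X * (2 * G) + C * X"
      using c n1 n2 n3 C X G by (intro add_mono mult_mono) auto
    also have "\<dots> = 2 * C * X * G * (K ^ 3 + K\<^sup>2 + K + 1) + C * X" by (simp add: algebra_simps)
    finally show ?thesis using small by linarith
  qed
  have "A * D1\<^sup>2 + B * g s * D2 = E * g s * D1 + R"
    using ode[of s] s by (simp add: D1_def D2_def D3_def R_def)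
  hence eq: "(A + B) * (K * g s)\<^sup>2 = E * g s * D1 + R - A * (D1\<^sup>2 - (K * g s)\<^sup>2) - B * (g s * (D2 - K\<^sup>2 * g s))"
    by (simp add: algebra_simps power2_eq_square)
  have "norm (x + y - z - t) \<le> norm x + norm y + norm z + norm t" for x y z t :: complex
    using norm_triangle_ineq4[of "x + y - z" t] norm_triangle_ineq4[of "x + y" z] norm_triangle_ineq[of x y] by linarith
  hence "norm ((A + B) * (K * g s)\<^sup>2) \<le> norm (E * g s * D1) + norm R + norm (A * (D1\<^sup>2 - (K * g s)\<^sup>2)) + norm (B * (g s * (D2 - K\<^sup>2 * g s)))"
    unfolding eq .
  also have "norm ((A + B) * (K * g s)\<^sup>2) = m * U"
    using K by (simp add: norm_mult norm_power m_def U_def G_def power_mult_distrib)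
  also have "norm (E * g s * D1) \<le> (p * m / 2) * G * ((1 + \<epsilon>) * (K * G))"
    using E n1' p m G by (simp only: norm_mult G_def m_def) (intro mult_mono, auto)
  also have "\<dots> \<le> (K * m / 2) * G * ((1 + \<epsilon>) * (K * G))"
    using Kp m G K eps by (intro mult_right_mono divide_right_mono) auto
  also have "\<dots> = (m / 2 + m / 2 * \<epsilon>) * U" by (simp add: U_def power2_eq_square algebra_simps)
  also have "norm (A * (D1\<^sup>2 - (K * g s)\<^sup>2)) \<le> norm A * (3 * \<epsilon> * U)"
    using sq by (simp only: norm_mult) (intro mult_left_mono, auto)
  also have "norm (B * (g s * (D2 - K\<^sup>2 * g s))) \<le> norm B * (\<epsilon> * U)"
  proof -
    have "norm (g s * (D2 - K\<^sup>2 * g s)) \<le> G * (\<epsilon> * K\<^sup>2 * G)"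
      using d2 G by (simp only: norm_mult G_def) (intro mult_left_mono, auto)
    thus ?thesis by (simp only: norm_mult[of B]) (intro mult_left_mono, auto simp: U_def power2_eq_square mult_ac)
  qed
  finally have "m * U \<le> (m / 2 + m / 2 * \<epsilon>) * U + 9 * C / N * U + norm A * (3 * \<epsilon> * U) + norm B * (\<epsilon> * U)"
    using R by simp
  also have "\<dots> = (m / 2 + \<epsilon> * M + 9 * C / N) * U" by (simp add: M_def algebra_simps)
  also have "\<dots> \<le> (m / 2 + m / 8 + m / 8) * U"
    using eps N U by (intro mult_right_mono add_mono) auto
  finally show False using m U by simp
qed

subsection \<open>Formal Laurent solutions\<close>

unbundle fps_syntax

text \<open>The numbers \<open>a\<close> and \<open>b\<close> need only be lower bounds for the
  orders. Thus the lowest coefficient may be zero, as happens when a constant term is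
  differentiated.\<close>

lemma fls_times_nth_lowest:
  fixes F G :: "'a::semiring_0 fls"
  assumes "\<And>k. k < a \<Longrightarrow> F $$ k = 0" and "\<And>k. k < b \<Longrightarrow> G $$ k = 0"
  shows "(F * G) $$ (a + b) = F $$ a * G $$ b"
proof (cases "F = 0 \<or> G = 0")
  case False
  hence le: "a \<le> fls_subdegree F" "b \<le> fls_subdegree G"
    by (auto intro!: fls_subdegree_geI assms)
  show ?thesis
  proof (cases "a = fls_subdegree F \<and> b = fls_subdegree G")
    case True
    thus ?thesis using fls_times_base[of F G] by simp
  next
    case False
    hence "a < fls_subdegree F \<or> b < fls_subdegree G" using le by auto
    hence "F $$ a * G $$ b = 0" by auto
    moreover have "(F * G) $$ (a + b) = 0" using False le by (intro fls_times_nth_eq0) auto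
    ultimately show ?thesis by simp
  qed
qed auto

definition fls_ode :: "complex \<Rightarrow> complex \<Rightarrow> complex \<Rightarrow> complex \<Rightarrow> complex \<Rightarrow> complex \<Rightarrow> complex fls \<Rightarrow> bool" where
  "fls_ode A B \<alpha> \<beta> \<gamma> \<delta> F \<longleftrightarrow>
     fls_const A * (fls_deriv F)\<^sup>2 + fls_const B * (F * fls_deriv (fls_deriv F))
       = fls_deriv (fls_deriv (fls_deriv F)) + fls_const \<alpha> * fls_deriv (fls_deriv F)
         + fls_const \<beta> * fls_deriv F + fls_const \<gamma> * F + fls_const \<delta>"

text \<open>At a pole of order n with leading coefficient e, the quadratic side starts in degree
  \<open>- 2 * n - 2\<close> with coefficient \<open>n * e\<^sup>2 * (n * (A + B) + B)\<close>, the
  linear side in degree \<open>- n - 3\<close>. For n >= 2 the first degree is lower, so that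
  coefficient would have to vanish. For n = 1 both degrees are -4, and comparing coefficients gives
  the residue.\<close>

lemma fls_ode_simple_pole:
  assumes ode: "fls_ode A B \<alpha> \<beta> \<gamma> \<delta> F" and neg: "fls_subdegree F < 0"
    and pole_order: "\<And>n::nat. n \<ge> 2 \<Longrightarrow> of_nat n * (A + B) + B \<noteq> 0"
  shows "fls_subdegree F = - 1" and "(A + 2 * B) * F $$ (-1) = - 6"
proof -
  define n where "n = - fls_subdegree F"
  have n: "n > 0" using neg by (simp add: n_def)
  define e where "e = F $$ (-n)"
  have "F \<noteq> 0" using neg by auto
  hence e: "e \<noteq> 0" by (simp add: e_def n_def nth_fls_subdegree_nonzero)
  have F: "F $$ k = 0" if "k < - n" for k using that by (simp add: n_def)
  have F1: "fls_deriv F $$ k = 0" if "k < - n - 1" for k using that F[of "k + 1"] by simp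
  have F2: "fls_deriv (fls_deriv F) $$ k = 0" if "k < - n - 2" for k using that F1[of "k + 1"] by simp
  have l1: "fls_deriv F $$ (- n - 1) = - of_int n * e" by (simp add: e_def)
  have l2: "fls_deriv (fls_deriv F) $$ (- n - 2) = of_int n * (of_int n + 1) * e"
    by (simp add: e_def algebra_simps)
  have l3: "fls_deriv (fls_deriv (fls_deriv F)) $$ (- n - 3) = - of_int n * (of_int n + 1) * (of_int n + 2) * e"
    by (simp add: e_def algebra_simps)
  have idx: "- n - 1 + (- n - 1) = - 2 * n - 2" "- n + (- n - 2) = - 2 * n - 2" by simp_all
  have sq: "((fls_deriv F)\<^sup>2) $$ (- 2 * n - 2) = (of_int n * e)\<^sup>2"
    using fls_times_nth_lowest[of "- n - 1" "fls_deriv F" "- n - 1" "fls_deriv F", OF F1 F1]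
    unfolding l1 idx power2_eq_square by simp
  have pr: "(F * fls_deriv (fls_deriv F)) $$ (- 2 * n - 2) = e * (of_int n * (of_int n + 1) * e)"
    using fls_times_nth_lowest[of "- n" F "- n - 2" "fls_deriv (fls_deriv F)", OF F F2]
    unfolding l2 e_def[symmetric] idx .
  have coeff: "A * ((fls_deriv F)\<^sup>2) $$ k + B * (F * fls_deriv (fls_deriv F)) $$ k
      = fls_deriv (fls_deriv (fls_deriv F)) $$ k + \<alpha> * fls_deriv (fls_deriv F) $$ k + \<beta> * fls_deriv F $$ k
        + \<gamma> * F $$ k + (if k = 0 then \<delta> else 0)" for k
    using arg_cong[OF ode[unfolded fls_ode_def], of "\<lambda>F. F $$ k"] by simp
  show n1: "fls_subdegree F = - 1"
  proof (rule ccontr)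
    assume "fls_subdegree F \<noteq> - 1"
    hence n2: "n \<ge> 2" using n by (simp add: n_def)
    have "A * (of_int n * e)\<^sup>2 + B * (e * (of_int n * (of_int n + 1) * e)) = 0"
      using coeff[of "- 2 * n - 2"] n2 unfolding sq pr by (simp add: F)
    hence "(of_int n * e\<^sup>2) * (of_int n * (A + B) + B) = 0"
      by (simp add: power2_eq_square algebra_simps)
    hence "of_int n * (A + B) + B = 0" using e n by simp
    moreover obtain N where "n = int N" using n by (metis nonneg_int_cases less_imp_le)
    ultimately show False using pole_order[of N] n2 by simp
  qed
  hence n1': "n = 1" by (simp add: n_def)
  have sq4: "((fls_deriv F)\<^sup>2) $$ (-4) = e * e"
    using sq unfolding n1' by (simp add: power2_eq_square del: fls_deriv_nth)
  have pr4: "(F * fls_deriv (fls_deriv F)) $$ (-4) = 2 * e * e"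
    using pr unfolding n1' by (simp del: fls_deriv_nth)
  have l34: "fls_deriv (fls_deriv (fls_deriv F)) $$ (-4) = - 6 * e"
    using l3 unfolding n1' by (simp del: fls_deriv_nth)
  have z: "fls_deriv (fls_deriv F) $$ (-4) = 0" "fls_deriv F $$ (-4) = 0" "F $$ (-4) = 0"
    by (rule F2 F1 F; simp add: n1')+
  have "A * (e * e) + B * (2 * e * e) = - 6 * e"
    using coeff[of "-4"] unfolding sq4 pr4 l34 z by simp
  hence "((A + 2 * B) * e) * e = - 6 * e" by (simp add: algebra_simps)
  hence "(A + 2 * B) * e = - 6" using e mult_right_cancel by blast
  thus "(A + 2 * B) * F $$ (-1) = - 6" by (simp add: e_def n1')
qed

text \<open>
  If \<open>F - G\<close> has order \<open>m\<close>, the lowest coefficient of the difference of the two equations is that of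
  the linearised equation; its indicial polynomial in \<open>n = m + 1\<close> is the quadratic in \<open>indices\<close>
  times \<open>n + 1\<close>.
\<close>
lemma fls_ode_unique:
  assumes odeF: "fls_ode A B \<alpha> \<beta> \<gamma> \<delta> F" and odeG: "fls_ode A B \<alpha> \<beta> \<gamma> \<delta> G"
    and negF: "fls_subdegree F = - 1" and negG: "fls_subdegree G = - 1"
    and resF: "(A + 2 * B) * F $$ (-1) = - 6" and resG: "(A + 2 * B) * G $$ (-1) = - 6"
    and indices: "\<And>n::nat. n \<ge> 1 \<Longrightarrow> (A + 2 * B) * of_nat n ^ 2 - (7 * A + 8 * B) * of_nat n + 6 * (A + 2 * B) \<noteq> 0"
  shows "F = G"
proof (rule ccontr)
  assume "F \<noteq> G"
  define E where "E = F - G"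
  define m where "m = fls_subdegree E"
  define e where "e = E $$ m"
  define \<rho> where "\<rho> = F $$ (-1)"
  have AB: "A + 2 * B \<noteq> 0" using resF by auto
  hence rho: "G $$ (-1) = \<rho>" using resF resG by (metis \<rho>_def mult_left_cancel)
  have E0: "E \<noteq> 0" using \<open>F \<noteq> G\<close> by (simp add: E_def)
  have e: "e \<noteq> 0" using E0 by (simp add: e_def m_def)
  have F: "F $$ k = 0" if "k < - 1" for k using that negF by simp
  have G: "G $$ k = 0" if "k < - 1" for k using that negG by simp
  \<comment> \<open>Both poles are simple with the same residue, so the principal parts
    cancel.\<close>
  have m0: "m \<ge> 0"
  proof (rule ccontr)
    assume "\<not> m \<ge> 0"
    hence "m = -1 \<or> m < -1" by linarith
    hence "e = 0" by (auto simp: e_def E_def rho \<rho>_def F G)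
    thus False using e by simp
  qed
  have E: "E $$ k = 0" if "k < m" for k using that by (simp add: m_def)
  have E1: "fls_deriv E $$ k = 0" if "k < m - 1" for k using that E[of "k + 1"] by simp
  have E2: "fls_deriv (fls_deriv E) $$ k = 0" if "k < m - 2" for k using that E1[of "k + 1"] by simp
  have l1: "fls_deriv E $$ (m - 1) = of_int m * e" by (simp add: e_def)
  have l2: "fls_deriv (fls_deriv E) $$ (m - 2) = of_int m * (of_int m - 1) * e"
    by (simp add: e_def algebra_simps)
  have l3: "fls_deriv (fls_deriv (fls_deriv E)) $$ (m - 3) = of_int m * (of_int m - 1) * (of_int m - 2) * e"
    by (simp add: e_def algebra_simps)
  \<comment> \<open>The difference of the quadratic sides is written linearly in \<open>E\<close>:
    \<open>F'\<^sup>2 - G'\<^sup>2 = S * E'\<close> and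
    \<open>F * F'' - G * G'' = F * E'' + G'' * E\<close>.\<close>
  define S where "S = fls_deriv F + fls_deriv G"
  have S: "S $$ k = 0" if "k < -2" for k using that F[of "k + 1"] G[of "k + 1"] by (simp add: S_def)
  have G2: "fls_deriv (fls_deriv G) $$ k = 0" if "k < -3" for k using that G[of "k + 2"] by (simp add: add.assoc)
  have S2: "S $$ (-2) = - 2 * \<rho>" by (simp add: S_def \<rho>_def rho)
  have idx: "-2 + (m - 1) = m - 3" "-1 + (m - 2) = m - 3" "-3 + m = m - 3" by simp_all
  have p1: "(S * fls_deriv E) $$ (m - 3) = - 2 * \<rho> * (of_int m * e)"
    using fls_times_nth_lowest[of "-2" S "m - 1" "fls_deriv E", OF S E1] unfolding l1 S2 idx .
  have p2: "(F * fls_deriv (fls_deriv E)) $$ (m - 3) = \<rho> * (of_int m * (of_int m - 1) * e)"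
    using fls_times_nth_lowest[of "-1" F "m - 2" "fls_deriv (fls_deriv E)", OF F E2] unfolding l2 \<rho>_def[symmetric] idx .
  have G3: "fls_deriv (fls_deriv G) $$ (-3) = 2 * \<rho>" by (simp add: rho)
  have p3: "(fls_deriv (fls_deriv G) * E) $$ (m - 3) = 2 * \<rho> * e"
    using fls_times_nth_lowest[of "-3" "fls_deriv (fls_deriv G)" m E, OF G2 E] unfolding G3 e_def[symmetric] idx .
  have "fls_const A * (S * fls_deriv E) + fls_const B * (F * fls_deriv (fls_deriv E) + fls_deriv (fls_deriv G) * E)
      = (fls_const A * (fls_deriv F)\<^sup>2 + fls_const B * (F * fls_deriv (fls_deriv F)))
        - (fls_const A * (fls_deriv G)\<^sup>2 + fls_const B * (G * fls_deriv (fls_deriv G)))"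
  proof -
    have "a * ((x + y) * (x - y)) + b * (f * (p - q) + q * (f - g)) = (a * (x * x) + b * (f * p)) - (a * (y * y) + b * (g * q))"
      for a b f g p q x y :: "complex fls"
      by (simp add: algebra_simps)
    thus ?thesis unfolding E_def S_def fls_deriv_sub power2_eq_square .
  qed
  also have "\<dots> = fls_deriv (fls_deriv (fls_deriv E)) + fls_const \<alpha> * fls_deriv (fls_deriv E)
         + fls_const \<beta> * fls_deriv E + fls_const \<gamma> * E"
  proof -
    have "(f3 + a * f2 + b * f1 + c * f + d) - (g3 + a * g2 + b * g1 + c * g + d)
        = (f3 - g3) + a * (f2 - g2) + b * (f1 - g1) + c * (f - g)"
      for a b c d f f1 f2 f3 g g1 g2 g3 :: "complex fls"
      by (simp add: algebra_simps)
    thus ?thesis unfolding odeF[unfolded fls_ode_def] odeG[unfolded fls_ode_def] E_def fls_deriv_sub .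
  qed
  finally have "fls_const A * (S * fls_deriv E) + fls_const B * (F * fls_deriv (fls_deriv E) + fls_deriv (fls_deriv G) * E)
      = fls_deriv (fls_deriv (fls_deriv E)) + fls_const \<alpha> * fls_deriv (fls_deriv E)
         + fls_const \<beta> * fls_deriv E + fls_const \<gamma> * E" .
  note odeE = this
  have z: "fls_deriv (fls_deriv E) $$ (m - 3) = 0" "fls_deriv E $$ (m - 3) = 0" "E $$ (m - 3) = 0"
    by (rule E2 E1 E, simp)+
  from arg_cong[OF odeE, of "\<lambda>F. F $$ (m - 3)"]
  have "A * (- 2 * \<rho> * (of_int m * e)) + B * (\<rho> * (of_int m * (of_int m - 1) * e) + 2 * \<rho> * e)
      = of_int m * (of_int m - 1) * (of_int m - 2) * e"
    unfolding fls_plus_nth fls_mult_const_nth p1 p2 p3 l3 z by (simp only: mult_zero_right add_0_right)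
  note * = this
  define \<mu> :: complex where "\<mu> = of_int m"
  \<comment> \<open>The residue is eliminated: the coefficient identity is multiplied by
    \<open>A + 2 * B\<close>, and \<open>(A + 2 * B) * \<rho> = - 6\<close> is inserted.\<close>
  have "((12 * A * \<mu> - 6 * B * (\<mu> * (\<mu> - 1) + 2)) - (A + 2 * B) * (\<mu> * (\<mu> - 1) * (\<mu> - 2))) * e
        = (A + 2 * B) * (A * (- 2 * \<rho> * (\<mu> * e)) + B * (\<rho> * (\<mu> * (\<mu> - 1) * e) + 2 * \<rho> * e)
            - \<mu> * (\<mu> - 1) * (\<mu> - 2) * e)
          - ((A + 2 * B) * \<rho> + 6) * ((A * (- 2 * (\<mu> * e)) + B * (\<mu> * (\<mu> - 1) * e + 2 * e)))"
    by (simp add: ring_distribs)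
  also have "A * (- 2 * \<rho> * (\<mu> * e)) + B * (\<rho> * (\<mu> * (\<mu> - 1) * e) + 2 * \<rho> * e)
      = \<mu> * (\<mu> - 1) * (\<mu> - 2) * e" by (rule *[folded \<mu>_def])
  also have "(A + 2 * B) * \<rho> = - 6" by (rule resF[folded \<rho>_def])
  also have "(A + 2 * B) * (\<mu> * (\<mu> - 1) * (\<mu> - 2) * e - \<mu> * (\<mu> - 1) * (\<mu> - 2) * e)
      - (- 6 + 6) * (A * (- 2 * (\<mu> * e)) + B * (\<mu> * (\<mu> - 1) * e + 2 * e)) = 0" by simp
  finally have "(12 * A * of_int m - 6 * B * (of_int m * (of_int m - 1) + 2)
      - (A + 2 * B) * (of_int m * (of_int m - 1) * (of_int m - 2))) * e = 0"
    unfolding \<mu>_def .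
  hence zero: "12 * A * of_int m - 6 * B * (of_int m * (of_int m - 1) + 2)
      - (A + 2 * B) * (of_int m * (of_int m - 1) * (of_int m - 2)) = 0"
    using e by simp
  have poly: "(\<mu> + 2) * ((A + 2 * B) * (\<mu> + 1)\<^sup>2 - (7 * A + 8 * B) * (\<mu> + 1) + 6 * (A + 2 * B))
      = - (12 * A * \<mu> - 6 * B * (\<mu> * (\<mu> - 1) + 2) - (A + 2 * B) * (\<mu> * (\<mu> - 1) * (\<mu> - 2)))"
    by algebra
  \<comment> \<open>The factor \<open>\<mu> + 2\<close> is the Fuchs index -1, which reflects the
    free position of the pole. It is excluded by \<open>m \<ge> 0\<close>.\<close>
  have "\<mu> + 2 \<noteq> 0"
  proof
    assume "\<mu> + 2 = 0"
    hence "of_int (m + 2) = (0::complex)" by (simp add: \<mu>_def)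
    thus False using m0 by (simp only: of_int_eq_0_iff)
  qed
  hence "(A + 2 * B) * (\<mu> + 1)\<^sup>2 - (7 * A + 8 * B) * (\<mu> + 1) + 6 * (A + 2 * B) = 0"
    using poly unfolding zero[folded \<mu>_def] minus_zero by (simp only: mult_eq_0_iff) blast
  moreover obtain M where "m = int M" using m0 nonneg_int_cases by blast
  hence "\<mu> + 1 = of_nat (M + 1)" by (simp add: \<mu>_def)
  ultimately show False using indices[of "M + 1"] by (metis le_add2)
qed

subsection \<open>Meromorphic solutions and their poles\<close>

text \<open>The coefficients are complex because a rescaling by a complex number does not preserve
  real ones.\<close>

definition ode_at :: "complex \<Rightarrow> complex \<Rightarrow> complex \<Rightarrow> complex \<Rightarrow> complex \<Rightarrow> complex \<Rightarrow> (complex \<Rightarrow> complex) \<Rightarrow> complex \<Rightarrow> bool" where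
  "ode_at A B \<alpha> \<beta> \<gamma> \<delta> v z \<longleftrightarrow>
     A * (deriv v z)\<^sup>2 + B * v z * deriv (deriv v) z
       = deriv (deriv (deriv v)) z + \<alpha> * deriv (deriv v) z + \<beta> * deriv v z + \<gamma> * v z + \<delta>"

text \<open>A nicely meromorphic function has value 0 at its poles and agrees with its limit
  elsewhere. Hence identities such as periodicity hold at every point and not only off a discrete
  set.\<close>

definition ode_solution :: "complex \<Rightarrow> complex \<Rightarrow> complex \<Rightarrow> complex \<Rightarrow> complex \<Rightarrow> complex \<Rightarrow> (complex \<Rightarrow> complex) \<Rightarrow> bool" where
  "ode_solution A B \<alpha> \<beta> \<gamma> \<delta> v \<longleftrightarrow>
     v nicely_meromorphic_on UNIV \<and> (\<forall>z. \<not> is_pole v z \<longrightarrow> ode_at A B \<alpha> \<beta> \<gamma> \<delta> v z)"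

section \<open>Identity principle and affine substitutions for meromorphic functions\<close>

lemma nicely_meromorphic_eq_if_eventually_eq:
  assumes f: "f nicely_meromorphic_on UNIV" and g: "g nicely_meromorphic_on UNIV"
    and ev: "eventually (\<lambda>z. f z = g z) (at z)"
  shows "f z = g z"
proof (cases "is_pole f z")
  case True
  hence "is_pole g z" using is_pole_cong[OF ev refl] by simp
  \<comment> \<open>At a pole both values are 0 by normalisation; elsewhere both are the common
    limit.\<close>
  moreover have "f z = 0" if "is_pole f z" "f nicely_meromorphic_on UNIV" for f
    using that unfolding nicely_meromorphic_on_def is_pole_def
    by (metis UNIV_I at_neq_bot not_tendsto_and_filterlim_at_infinity)
  ultimately show ?thesis using True f g by metis
next
  case False
  hence "\<not> is_pole g z" using is_pole_cong[OF ev refl] by simp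
  hence "f \<midarrow>z\<rightarrow> f z" "g \<midarrow>z\<rightarrow> g z"
    using False f g unfolding nicely_meromorphic_on_def by blast+
  moreover from this(1) have "g \<midarrow>z\<rightarrow> f z" using ev by (simp cong: tendsto_cong)
  ultimately show ?thesis using tendsto_unique[OF at_neq_bot] by blast
qed

text \<open>The difference may have removable singularities where poles cancel. After removing them
  it vanishes near \<open>a\<close>, hence everywhere, and the normalisation turns equality near a
  point into equality at it.\<close>

lemma nicely_meromorphic_identity:
  assumes f: "f nicely_meromorphic_on UNIV" and g: "g nicely_meromorphic_on UNIV"
    and ev: "eventually (\<lambda>z. f z = g z) (at a)"
  shows "f z = g z"
proof -
  define D where "D z = f z - g z" for z
  have D: "D meromorphic_on UNIV"
    using f g unfolding D_def nicely_meromorphic_on_def by (intro meromorphic_intros) auto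
  have iso: "isolated_singularity_at D z" for z
    using D by (intro meromorphic_on_isolated_singularity meromorphic_on_subset[OF D]) auto
  have "eventually (\<lambda>z. remove_sings D z = 0) (at a)"
    using eventually_remove_sings_eq_at[OF iso[of a]] ev by eventually_elim (simp add: D_def)
  hence "frequently (\<lambda>z. remove_sings D z = 0) (at a)"
    by (simp add: eventually_frequently)
  hence zero: "remove_sings D w = 0" for w
    using frequently_eq_meromorphic_imp_constant[of _ 0 a UNIV w] remove_sings_nicely_meromorphic[OF D] by auto
  have "eventually (\<lambda>w. f w = g w) (at z)"
    using eventually_remove_sings_eq_at[OF iso[of z]] by eventually_elim (simp add: D_def zero)
  thus ?thesis by (rule nicely_meromorphic_eq_if_eventually_eq[OF f g])
qed

lemma filtermap_affine_at:
  fixes \<kappa> :: complex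
  assumes "\<kappa> \<noteq> 0"
  shows "filtermap (\<lambda>z. \<kappa> * z + c) (at z) = at (\<kappa> * z + c)"
proof (rule filtermap_fun_inverse[where g = "\<lambda>w. (w - c) / \<kappa>"])
  have "((\<lambda>w. (w - c) / \<kappa>) \<longlongrightarrow> ((\<kappa> * z + c) - c) / \<kappa>) (at (\<kappa> * z + c))"
    by (intro tendsto_intros assms)
  moreover have "eventually (\<lambda>w. (w - c) / \<kappa> \<noteq> z) (at (\<kappa> * z + c))"
    using assms by (auto simp: eventually_at_filter field_simps)
  ultimately show "filterlim (\<lambda>w. (w - c) / \<kappa>) (at z) (at (\<kappa> * z + c))"
    using assms by (simp add: filterlim_at)
  have "((\<lambda>z. \<kappa> * z + c) \<longlongrightarrow> \<kappa> * z + c) (at z)" by (intro tendsto_intros)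
  moreover have "eventually (\<lambda>w. \<kappa> * w + c \<noteq> \<kappa> * z + c) (at z)"
    using assms by (auto simp: eventually_at_filter)
  ultimately show "filterlim (\<lambda>z. \<kappa> * z + c) (at (\<kappa> * z + c)) (at z)"
    by (simp add: filterlim_at)
qed (use assms in auto)

lemma is_pole_affine:
  fixes \<kappa> :: complex
  assumes "\<kappa> \<noteq> 0"
  shows "is_pole (\<lambda>z. v (\<kappa> * z + c)) z \<longleftrightarrow> is_pole v (\<kappa> * z + c)"
  using is_pole_compose_iff[OF filtermap_affine_at[OF assms], of v] by (simp add: o_def)

lemma nicely_meromorphic_on_affine:
  assumes v: "v nicely_meromorphic_on UNIV" and \<kappa>: "\<kappa> \<noteq> 0"
  shows "(\<lambda>z. v (\<kappa> * z + c)) nicely_meromorphic_on UNIV"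
  unfolding nicely_meromorphic_on_def
proof (intro conjI ballI)
  show "(\<lambda>z. v (\<kappa> * z + c)) meromorphic_on UNIV"
    by (rule meromorphic_on_compose[where A = UNIV])
       (use v in \<open>auto simp: nicely_meromorphic_on_def intro!: analytic_intros\<close>)
  fix z
  have "(is_pole v (\<kappa> * z + c) \<and> v (\<kappa> * z + c) = 0) \<or> v \<midarrow>\<kappa> * z + c\<rightarrow> v (\<kappa> * z + c)"
    using v by (simp add: nicely_meromorphic_on_def)
  thus "is_pole (\<lambda>z. v (\<kappa> * z + c)) z \<and> v (\<kappa> * z + c) = 0 \<or> (\<lambda>z. v (\<kappa> * z + c)) \<midarrow>z\<rightarrow> v (\<kappa> * z + c)"
    unfolding is_pole_affine[OF \<kappa>] filterlim_def filtermap_affine_at[OF \<kappa>, of c z, symmetric]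
    by (simp add: filtermap_filtermap)
qed

lemma nicely_meromorphic_holomorphic_compl_poles:
  assumes "v nicely_meromorphic_on UNIV"
  shows "open {z. \<not> is_pole v z}" "v holomorphic_on {z. \<not> is_pole v z}"
proof -
  have an: "v analytic_on {z. \<not> is_pole v z}"
    using nicely_meromorphic_on_imp_analytic_at[OF assms] by (subst analytic_on_analytic_at) auto
  show "v holomorphic_on {z. \<not> is_pole v z}" by (rule analytic_imp_holomorphic[OF an])
  obtain S where S: "open S" "{z. \<not> is_pole v z} \<subseteq> S" "v holomorphic_on S"
    using an by (auto simp: analytic_on_holomorphic)
  have "S \<subseteq> {z. \<not> is_pole v z}"
    using analytic_at_imp_no_pole holomorphic_on_imp_analytic_at[OF S(3,1)] by blast
  thus "open {z. \<not> is_pole v z}" using S by (metis subset_antisym)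
qed

text \<open>At a removable singularity of \<open>u\<close> the equation is not given. It holds on a
  punctured neighbourhood, and the residual \<open>D\<close> of the equation is continuous where the
  repaired function is holomorphic.\<close>

lemma ode_solution_remove_sings:
  assumes mero: "u meromorphic_on UNIV"
    and ode: "\<And>z. u analytic_on {z} \<Longrightarrow> ode_at A B \<alpha> \<beta> \<gamma> \<delta> u z"
  shows "ode_solution A B \<alpha> \<beta> \<gamma> \<delta> (remove_sings u)"
proof -
  define v where "v = remove_sings u"
  have nice: "v nicely_meromorphic_on UNIV" unfolding v_def by (rule remove_sings_nicely_meromorphic[OF mero])
  define S where "S = {z. \<not> is_pole v z}"
  have S: "open S" "v holomorphic_on S"
    unfolding S_def using nicely_meromorphic_holomorphic_compl_poles[OF nice] by auto
  have at_analytic: "ode_at A B \<alpha> \<beta> \<gamma> \<delta> v z" if "u analytic_on {z}" for z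
  proof -
    have ev: "eventually (\<lambda>w. v w = u w) (nhds z)"
      unfolding v_def by (rule eventually_remove_sings_eq_nhds[OF that])
    have "(deriv ^^ n) v z = (deriv ^^ n) u z" for n by (rule higher_deriv_cong_ev[OF ev refl])
    from this[of 0] this[of 1] this[of 2] this[of 3] ode[OF that] show ?thesis
      by (simp add: ode_at_def numeral_2_eq_2 numeral_3_eq_3)
  qed
  have "ode_at A B \<alpha> \<beta> \<gamma> \<delta> v z" if z: "z \<in> S" for z
  proof -
    define D where "D z = A * (deriv v z)\<^sup>2 + B * v z * deriv (deriv v) z
       - (deriv (deriv (deriv v)) z + \<alpha> * deriv (deriv v) z + \<beta> * deriv v z + \<gamma> * v z + \<delta>)" for z
    have "D holomorphic_on S" unfolding D_def by (intro holomorphic_intros S)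
    hence "isCont D z" using S z holomorphic_on_imp_continuous_on continuous_on_eq_continuous_at by blast
    hence "D \<midarrow>z\<rightarrow> D z" by (simp add: isCont_def)
    have "isolated_singularity_at u z"
      by (intro meromorphic_on_isolated_singularity meromorphic_on_subset[OF mero]) auto
    then obtain r where r: "r > 0" "u analytic_on ball z r - {z}"
      unfolding isolated_singularity_at_def by blast
    have "D w = 0" if "w \<in> ball z r - {z}" for w
    proof -
      have "u analytic_on {w}" using r(2) by (rule analytic_on_subset) (use that in auto)
      thus ?thesis using at_analytic[of w] by (simp add: D_def ode_at_def)
    qed
    hence "eventually (\<lambda>w. D w = 0) (at z)"
      using eventually_at_in_open[of "ball z r" z] r(1) by (auto elim!: eventually_mono)
    hence "D \<midarrow>z\<rightarrow> 0" by (rule tendsto_eventually)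
    hence "D z = 0" using \<open>D \<midarrow>z\<rightarrow> D z\<close> tendsto_unique[OF at_neq_bot] by blast
    thus ?thesis by (simp add: D_def ode_at_def)
  qed
  thus ?thesis using nice unfolding ode_solution_def S_def v_def by blast
qed

text \<open>The equation is multiplied by \<open>\<kappa> ^ 3\<close>, which keeps the coefficient
  of the third derivative equal to 1; each other coefficient retains the powers of
  \<open>\<kappa>\<close> that its derivatives do not consume.\<close>

lemma ode_solution_affine:
  assumes sol: "ode_solution A B \<alpha> \<beta> \<gamma> \<delta> v" and \<kappa>: "\<kappa> \<noteq> 0"
  shows "ode_solution (\<kappa> * A) (\<kappa> * B) (\<kappa> * \<alpha>) (\<kappa>\<^sup>2 * \<beta>) (\<kappa> ^ 3 * \<gamma>) (\<kappa> ^ 3 * \<delta>) (\<lambda>s. v (\<kappa> * s + c))"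
  unfolding ode_solution_def
proof (intro conjI allI impI)
  have nice: "v nicely_meromorphic_on UNIV" using sol by (simp add: ode_solution_def)
  show "(\<lambda>s. v (\<kappa> * s + c)) nicely_meromorphic_on UNIV"
    by (rule nicely_meromorphic_on_affine[OF nice \<kappa>])
  fix s assume "\<not> is_pole (\<lambda>s. v (\<kappa> * s + c)) s"
  hence s: "\<not> is_pole v (\<kappa> * s + c)" by (simp add: is_pole_affine[OF \<kappa>])
  define S where "S = {z. \<not> is_pole v z}"
  have S: "open S" "v holomorphic_on S"
    unfolding S_def using nicely_meromorphic_holomorphic_compl_poles[OF nice] by auto
  have "open ((\<lambda>s. \<kappa> * s + c) -` S)"
    by (intro open_vimage S continuous_intros)
  hence "(deriv ^^ n) (\<lambda>s. v (\<kappa> * s + c)) s = \<kappa> ^ n * (deriv ^^ n) v (\<kappa> * s + c)" for n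
    using s by (intro higher_deriv_compose_linear'[OF S(2) _ S(1)]) (auto simp: S_def)
  from this[of 1] this[of 2] this[of 3]
  have d: "deriv (\<lambda>s. v (\<kappa> * s + c)) s = \<kappa> * deriv v (\<kappa> * s + c)"
    "deriv (deriv (\<lambda>s. v (\<kappa> * s + c))) s = \<kappa>\<^sup>2 * deriv (deriv v) (\<kappa> * s + c)"
    "deriv (deriv (deriv (\<lambda>s. v (\<kappa> * s + c)))) s = \<kappa> ^ 3 * deriv (deriv (deriv v)) (\<kappa> * s + c)"
    by (simp_all add: numeral_2_eq_2 numeral_3_eq_3)
  have "ode_at A B \<alpha> \<beta> \<gamma> \<delta> v (\<kappa> * s + c)" using sol s by (simp add: ode_solution_def)
  hence "\<kappa> ^ 3 * (A * (deriv v (\<kappa> * s + c))\<^sup>2 + B * v (\<kappa> * s + c) * deriv (deriv v) (\<kappa> * s + c))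
    = \<kappa> ^ 3 * (deriv (deriv (deriv v)) (\<kappa> * s + c) + \<alpha> * deriv (deriv v) (\<kappa> * s + c)
        + \<beta> * deriv v (\<kappa> * s + c) + \<gamma> * v (\<kappa> * s + c) + \<delta>)"
    by (simp only: ode_at_def)
  thus "ode_at (\<kappa> * A) (\<kappa> * B) (\<kappa> * \<alpha>) (\<kappa>\<^sup>2 * \<beta>) (\<kappa> ^ 3 * \<gamma>) (\<kappa> ^ 3 * \<delta>) (\<lambda>s. v (\<kappa> * s + c)) s"
    unfolding ode_at_def d by (simp add: power2_eq_square power3_eq_cube ring_distribs mult_ac)
qed

lemma ode_solution_laurent:
  assumes sol: "ode_solution A B \<alpha> \<beta> \<gamma> \<delta> v" and pole: "is_pole v z"
  obtains F where "(\<lambda>h. v (z + h)) has_laurent_expansion F" "fls_subdegree F < 0" "fls_ode A B \<alpha> \<beta> \<gamma> \<delta> F"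
proof -
  have nice: "v nicely_meromorphic_on UNIV" using sol by (simp add: ode_solution_def)
  hence mero: "v meromorphic_on UNIV" by (simp add: nicely_meromorphic_on_def)
  define f where "f h = v (z + h)" for h
  obtain F where F: "f has_laurent_expansion F"
    using mero unfolding meromorphic_on_def f_def by blast
  have deriv_shift: "deriv (\<lambda>h. g (z + h)) = (\<lambda>h. deriv g (z + h))" for g :: "complex \<Rightarrow> complex"
    by (rule ext) (simp add: deriv_def DERIV_shift[symmetric] add.commute[of z])
  have f_eq: "f = (\<lambda>h. v (z + h))" by (rule ext) (simp add: f_def)
  have "isolated_singularity_at v z"
    by (intro meromorphic_on_isolated_singularity meromorphic_on_subset[OF mero]) auto
  then obtain r where r: "r > 0" "v analytic_on ball z r - {z}"
    unfolding isolated_singularity_at_def by blast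
  have "A * (deriv f h)\<^sup>2 + B * (f h * deriv (deriv f) h)
      = deriv (deriv (deriv f)) h + \<alpha> * deriv (deriv f) h + \<beta> * deriv f h + \<gamma> * f h + \<delta>" if "h \<in> ball 0 r - {0}" for h
  proof -
    have "v analytic_on {z + h}" using r(2) by (rule analytic_on_subset) (use that in \<open>auto simp: dist_norm\<close>)
    hence "\<not> is_pole v (z + h)" using analytic_at_imp_no_pole by blast
    hence "ode_at A B \<alpha> \<beta> \<gamma> \<delta> v (z + h)" using sol by (simp add: ode_solution_def)
    thus ?thesis unfolding f_eq deriv_shift by (simp add: ode_at_def mult.assoc)
  qed
  hence ev: "eventually (\<lambda>h. A * (deriv f h)\<^sup>2 + B * (f h * deriv (deriv f) h)
      = deriv (deriv (deriv f)) h + \<alpha> * deriv (deriv f) h + \<beta> * deriv f h + \<gamma> * f h + \<delta>) (at 0)"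
    using eventually_at_in_open[of "ball 0 r" 0] r(1) by (auto elim!: eventually_mono)
  have 1: "(\<lambda>h. A * (deriv f h)\<^sup>2 + B * (f h * deriv (deriv f) h)) has_laurent_expansion
        fls_const A * (fls_deriv F)\<^sup>2 + fls_const B * (F * fls_deriv (fls_deriv F))"
    by (intro laurent_expansion_intros F)
  have 2: "(\<lambda>h. deriv (deriv (deriv f)) h + \<alpha> * deriv (deriv f) h + \<beta> * deriv f h + \<gamma> * f h + \<delta>) has_laurent_expansion
        fls_deriv (fls_deriv (fls_deriv F)) + fls_const \<alpha> * fls_deriv (fls_deriv F)
         + fls_const \<beta> * fls_deriv F + fls_const \<gamma> * F + fls_const \<delta>"
    by (intro laurent_expansion_intros F)
  have "fls_ode A B \<alpha> \<beta> \<gamma> \<delta> F"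
    unfolding fls_ode_def using has_laurent_expansion_unique 1 2 has_laurent_expansion_cong[OF ev refl] by blast
  moreover have "fls_subdegree F < 0"
    using pole F unfolding f_def by (simp add: is_pole_fls_subdegree_iff)
  ultimately show ?thesis using that F unfolding f_def by blast
qed

lemma ode_solution_poles:
  assumes sol: "ode_solution A B \<alpha> \<beta> \<gamma> \<delta> v"
    and pole_order: "\<And>n::nat. n \<ge> 2 \<Longrightarrow> of_nat n * (A + B) + B \<noteq> 0"
    and indices: "\<And>n::nat. A + 2 * B \<noteq> 0 \<Longrightarrow> n \<ge> 1 \<Longrightarrow> (A + 2 * B) * of_nat n ^ 2 - (7 * A + 8 * B) * of_nat n + 6 * (A + 2 * B) \<noteq> 0"
    and z1: "is_pole v z1"
  shows "residue v z1 \<noteq> 0" and "(A + 2 * B) * residue v z1 = - 6"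
    and "(\<lambda>h. h * v (z1 + h)) \<midarrow>0\<rightarrow> residue v z1"
    and "is_pole v z2 \<Longrightarrow> v (z + (z2 - z1)) = v z"
proof -
  obtain F where F: "(\<lambda>h. v (z1 + h)) has_laurent_expansion F" "fls_subdegree F < 0" "fls_ode A B \<alpha> \<beta> \<gamma> \<delta> F"
    using ode_solution_laurent[OF sol z1] by blast
  note F' = fls_ode_simple_pole[OF F(3,2) pole_order]
  have "F \<noteq> 0" using F(2) by auto
  have "(\<lambda>h. h * v (z1 + h)) has_laurent_expansion (fls_X * F)"
    by (intro laurent_expansion_intros F)
  moreover have "fls_subdegree (fls_X * F) = 0"
    using F'(1) \<open>F \<noteq> 0\<close> by (simp add: fls_subdegree_mult_fls_X)
  ultimately have "(\<lambda>h. h * v (z1 + h)) \<midarrow>0\<rightarrow> (fls_X * F) $$ 0"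
    using has_laurent_expansion_imp_tendsto_0 by force
  thus "(\<lambda>h. h * v (z1 + h)) \<midarrow>0\<rightarrow> residue v z1"
    using has_laurent_expansion_residue[OF F(1)] by (simp add: fls_X_times_conv_shift)
  show res: "(A + 2 * B) * residue v z1 = - 6"
    using has_laurent_expansion_residue[OF F(1)] F'(2) by simp
  thus "residue v z1 \<noteq> 0" by auto
  \<comment> \<open>The existence of a pole rules out \<open>A + 2 * B = 0\<close>, since the
    residue relation would read \<open>0 = - 6\<close>. This discharges the premise of
    \<open>indices\<close>.\<close>
  have AB: "A + 2 * B \<noteq> 0" using res by auto
  assume z2: "is_pole v z2"
  obtain G where G: "(\<lambda>h. v (z2 + h)) has_laurent_expansion G" "fls_subdegree G < 0" "fls_ode A B \<alpha> \<beta> \<gamma> \<delta> G"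
    using ode_solution_laurent[OF sol z2] by blast
  note G' = fls_ode_simple_pole[OF G(3,2) pole_order]
  have "F = G"
    by (rule fls_ode_unique[OF F(3) G(3) F'(1) G'(1) F'(2) G'(2) indices[OF AB]])
  hence "eventually (\<lambda>h. eval_fls F h = v (z1 + h)) (at 0)" "eventually (\<lambda>h. eval_fls F h = v (z2 + h)) (at 0)"
    using F(1) G(1) by (auto simp: has_laurent_expansion_def)
  hence "eventually (\<lambda>h. v (z2 + h) = v (z1 + h)) (at 0)" by eventually_elim simp
  hence ev: "eventually (\<lambda>w. v (w + (z2 - z1)) = v w) (at z1)"
    by (subst eventually_at_to_0) (simp add: add_ac)
  have nice: "v nicely_meromorphic_on UNIV" using sol by (simp add: ode_solution_def)
  show "v (z + (z2 - z1)) = v z"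
    using nicely_meromorphic_identity[OF nicely_meromorphic_on_affine[OF nice, of 1 "z2 - z1"] nice] ev by simp
qed

subsection \<open>Solutions with at most one pole\<close>

text \<open>Multiplication by \<open>h\<close> raises the order by one only, so from a negative
  order it cannot reach a positive one.\<close>

lemma not_pole_if_times_tendsto_0:
  assumes D: "D meromorphic_on UNIV" and lim: "(\<lambda>h. h * D (z + h)) \<midarrow>0\<rightarrow> 0"
  shows "\<not> is_pole D z"
proof
  assume pole: "is_pole D z"
  obtain F where F: "(\<lambda>h. D (z + h)) has_laurent_expansion F"
    using D unfolding meromorphic_on_def by blast
  have neg: "fls_subdegree F < 0" using pole F by (simp add: is_pole_fls_subdegree_iff)
  hence F0: "F \<noteq> 0" by auto
  have "(\<lambda>h. h * D (z + h)) has_laurent_expansion (fls_X * F)"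
    by (intro laurent_expansion_intros F)
  hence "fls_subdegree (fls_X * F) > 0"
    using tendsto_0_subdegree_iff_0[of _ "fls_X * F"] F0 lim by simp
  thus False using neg F0 by (simp add: fls_subdegree_mult_fls_X)
qed

text \<open>For simple poles the limit of \<open>h * v (z + h)\<close> is the whole principal part.
  Agreement of these limits thus makes the singularities of \<open>v - w\<close> removable;
  \<open>w\<close> will be an explicit comparison function.\<close>

lemma entire_difference:
  assumes v: "v meromorphic_on UNIV" and w: "w meromorphic_on UNIV"
    and poles: "\<And>z. is_pole v z \<or> is_pole w z \<Longrightarrow>
      \<exists>\<rho>. (\<lambda>h. h * v (z + h)) \<midarrow>0\<rightarrow> \<rho> \<and> (\<lambda>h. h * w (z + h)) \<midarrow>0\<rightarrow> \<rho>"
  obtains f where "f holomorphic_on UNIV" "\<And>z. v analytic_on {z} \<Longrightarrow> w analytic_on {z} \<Longrightarrow> f z = v z - w z"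
proof
  define D where "D = (\<lambda>z. v z - w z)"
  have D: "D meromorphic_on UNIV" unfolding D_def by (intro meromorphic_intros v w)
  have "\<not> is_pole D z" for z
  proof (cases "is_pole v z \<or> is_pole w z")
    case True
    then obtain \<rho> where "(\<lambda>h. h * v (z + h)) \<midarrow>0\<rightarrow> \<rho>" "(\<lambda>h. h * w (z + h)) \<midarrow>0\<rightarrow> \<rho>"
      using poles by blast
    hence "(\<lambda>h. h * v (z + h) - h * w (z + h)) \<midarrow>0\<rightarrow> \<rho> - \<rho>" by (rule tendsto_diff)
    thus ?thesis by (intro not_pole_if_times_tendsto_0[OF D]) (simp add: D_def algebra_simps)
  next
    case False
    have lim: "\<exists>c. g \<midarrow>z\<rightarrow> c" if "\<not> is_pole g z" "g meromorphic_on UNIV" for g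
      using that meromorphic_on_not_essential[of g z] meromorphic_on_subset[of g UNIV "{z}"]
      unfolding not_essential_def by auto
    obtain a b where "v \<midarrow>z\<rightarrow> a" "w \<midarrow>z\<rightarrow> b" using False lim[OF _ v] lim[OF _ w] by blast
    hence "D \<midarrow>z\<rightarrow> a - b" unfolding D_def by (rule tendsto_diff)
    thus ?thesis unfolding is_pole_def using not_tendsto_and_filterlim_at_infinity[OF at_neq_bot] by blast
  qed
  moreover have sing: "isolated_singularity_at D z" "not_essential D z" for z
    using D meromorphic_on_subset[of D UNIV "{z}"] meromorphic_on_isolated_singularity meromorphic_on_not_essential by auto
  ultimately have "\<not> is_pole (remove_sings D) z" for z by (simp add: is_pole_remove_sings_iff)
  hence "remove_sings D analytic_on {z}" for z
    using nicely_meromorphic_on_imp_analytic_at[OF remove_sings_nicely_meromorphic[OF D]] by simp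
  hence "remove_sings D analytic_on UNIV" by (subst analytic_on_analytic_at) simp
  thus "remove_sings D holomorphic_on UNIV" by (rule analytic_imp_holomorphic)
  show "remove_sings D z = v z - w z" if "v analytic_on {z}" "w analytic_on {z}" for z
  proof -
    have "D analytic_on {z}" unfolding D_def by (intro analytic_intros that)
    thus ?thesis by (simp add: D_def)
  qed
qed

text \<open>With \<open>z = exp s\<close> one has \<open>z * v' = g'\<close> and
  \<open>z\<^sup>2 * v'' = g'' - g'\<close>. Multiplying the equation by \<open>z\<^sup>2\<close>
  gives an equation of the required shape with \<open>E = B\<close>. The factor
  \<open>exp (p * Re s)\<close> in the resulting bound is a power of \<open>norm z\<close>, and
  \<open>Re s\<close> is its logarithm.\<close>

lemma ode_solution_growth:
  assumes sol: "ode_solution A B \<alpha> \<beta> \<gamma> \<delta> v" and AB: "A + B \<noteq> 0"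
    and poles: "\<And>z. is_pole v z \<Longrightarrow> z = 0"
  shows "\<exists>C (n::nat). \<forall>z. norm z \<ge> exp 1 \<longrightarrow> norm (v z) \<le> C * norm z ^ n"
proof -
  have nice: "v nicely_meromorphic_on UNIV" using sol by (simp add: ode_solution_def)
  have holv: "v holomorphic_on - {0}"
    by (rule holomorphic_on_subset[OF nicely_meromorphic_holomorphic_compl_poles(2)[OF nice]]) (use poles in auto)
  have op: "open (- {0::complex})" by auto
  define V where "V k s = (deriv ^^ k) v (exp s)" for k s
  have dV: "(V k has_field_derivative V (Suc k) s * exp s) (at s)" for k s
  proof -
    have "((deriv ^^ k) v has_field_derivative (deriv ^^ Suc k) v (exp s)) (at (exp s))"
      by (rule has_field_derivative_higher_deriv[OF holv op]) simp
    from DERIV_chain2[OF this DERIV_exp] show ?thesis by (simp add: V_def[abs_def])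
  qed
  note [derivative_intros] = DERIV_chain2[OF dV]
  define g where "g s = v (exp s)" for s
  have g_eq: "g = V 0" by (rule ext) (simp add: g_def V_def)
  have g1: "deriv g = (\<lambda>s. V 1 s * exp s)"
    by (rule ext, rule DERIV_imp_deriv) (auto simp: g_eq intro!: derivative_eq_intros dV)
  have g2: "deriv (deriv g) = (\<lambda>s. V 2 s * exp s ^ 2 + V 1 s * exp s)"
    unfolding g1 by (rule ext, rule DERIV_imp_deriv)
      (auto intro!: derivative_eq_intros simp: numeral_2_eq_2 algebra_simps)
  have g3: "deriv (deriv (deriv g)) = (\<lambda>s. V 3 s * exp s ^ 3 + 3 * V 2 s * exp s ^ 2 + V 1 s * exp s)"
    unfolding g2 by (rule ext, rule DERIV_imp_deriv)
      (auto intro!: derivative_eq_intros simp: power2_eq_square power3_eq_cube eval_nat_numeral algebra_simps)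
  \<comment> \<open>The entry 2 covers the coefficients of size \<open>exp (2 * Re s)\<close>; the
    other entry makes \<open>E = B\<close> satisfy its smallness condition.\<close>
  define p where "p = max 2 (2 * norm B / norm (A + B))"
  define C where "C = 6 + norm \<alpha> + norm \<beta> + norm \<gamma> + norm \<delta>"
  have "\<exists>C' (n::nat). \<forall>s. Re s \<ge> 1 \<longrightarrow> norm (g s) \<le> C' * exp (p * Re s) * Re s ^ n"
  \<comment> \<open>The coefficients come from
    \<open>z\<^sup>2 * v''' = exp (- s) * (g''' - 3 * g'' + 2 * g')\<close>, together with the
    expressions for \<open>v''\<close> and \<open>v'\<close>.\<close>
  proof (rule quadratic_ode_growth[where A = A and B = B and E = B and C = C
        and ?c3.0 = "\<lambda>s. exp (- s)" and ?c2.0 = "\<lambda>s. \<alpha> - 3 * exp (- s)" and ?c1.0 = "\<lambda>s. 2 * exp (- s) - \<alpha> + \<beta> * exp s"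
        and ?c0.0 = "\<lambda>s. \<gamma> * exp s ^ 2" and c = "\<lambda>s. \<delta> * exp s ^ 2"])
    show "g holomorphic_on {s. Re s > 0}"
      unfolding g_eq using dV by (meson holomorphic_onI field_differentiable_at_within field_differentiable_def)
    show "g (s + 2 * pi * \<i>) = g s" for s
      by (simp add: g_def exp_add exp_two_pi_i mult_ac)
    show "p \<ge> 0" by (simp add: p_def)
    show "A + B \<noteq> 0" by fact
    have "2 * norm B / norm (A + B) \<le> p" by (simp add: p_def)
    thus "norm B \<le> p * norm (A + B) / 2" using AB by (simp add: field_simps)
  next
    fix s :: complex
    have "\<not> is_pole v (exp s)" using poles[of "exp s"] by auto
    hence "A * (V 1 s)\<^sup>2 + B * V 0 s * V 2 s = V 3 s + \<alpha> * V 2 s + \<beta> * V 1 s + \<gamma> * V 0 s + \<delta>"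
      using sol by (auto simp: ode_solution_def ode_at_def V_def numeral_2_eq_2 numeral_3_eq_3)
    hence eq: "V 3 s = A * (V 1 s)\<^sup>2 + B * V 0 s * V 2 s - (\<alpha> * V 2 s + \<beta> * V 1 s + \<gamma> * V 0 s + \<delta>)"
      by (simp add: algebra_simps)
    have e: "exp (- s) * exp s = 1" by (simp flip: exp_add)
    have d2: "(deriv ^^ 2) g = deriv (deriv g)" and d3: "(deriv ^^ 3) g = deriv (deriv (deriv g))"
      by (simp_all add: numeral_2_eq_2 numeral_3_eq_3)
    show "A * (deriv g s)\<^sup>2 + B * g s * (deriv ^^ 2) g s = B * g s * deriv g s
        + exp (- s) * (deriv ^^ 3) g s + (\<alpha> - 3 * exp (- s)) * (deriv ^^ 2) g s
        + (2 * exp (- s) - \<alpha> + \<beta> * exp s) * deriv g s + \<gamma> * exp s ^ 2 * g s + \<delta> * exp s ^ 2"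
      unfolding d3 g3 unfolding d2 g2 unfolding g1 unfolding g_eq using eq e by algebra
  next
    fix s :: complex assume s: "Re s > 0"
    define E where "E = exp (p * Re s)"
    have E2: "exp (2 * Re s) \<le> E" using s by (auto simp: E_def p_def)
    have E1: "exp (Re s) \<le> exp (2 * Re s)" "1 \<le> exp (Re s)" "exp (- Re s) \<le> 1" using s by auto
    have sq: "norm (exp s ^ 2) = exp (2 * Re s)" by (simp add: norm_power exp_double)
    have b: "norm (exp (- s)) \<le> E" "norm (exp s) \<le> E" "norm (exp s ^ 2) \<le> E" "1 \<le> E"
      using E1 E2 unfolding sq norm_exp_eq_Re uminus_complex.sel by linarith+
    have C: "1 \<le> C" "norm \<alpha> + 3 \<le> C" "2 + norm \<alpha> + norm \<beta> \<le> C" "norm \<gamma> \<le> C" "norm \<delta> \<le> C"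
      unfolding C_def using norm_ge_zero[of \<alpha>] norm_ge_zero[of \<beta>] norm_ge_zero[of \<gamma>] norm_ge_zero[of \<delta>] by linarith+
    have n1: "norm (exp (- s)) \<le> C * E"
      using b mult_right_mono[OF C(1), of E] by linarith
    have "norm (\<alpha> - 3 * exp (- s)) \<le> norm \<alpha> + 3 * norm (exp (- s))"
      using norm_triangle_ineq4[of \<alpha> "3 * exp (- s)"] by (simp add: norm_mult)
    also have "\<dots> \<le> norm \<alpha> * E + 3 * E" using b by (intro add_mono mult_left_mono) (auto simp: mult_le_cancel_left1)
    also have "\<dots> = (norm \<alpha> + 3) * E" by (simp add: algebra_simps)
    also have "\<dots> \<le> C * E" using b C by (intro mult_right_mono) auto
    finally have n2: "norm (\<alpha> - 3 * exp (- s)) \<le> C * E" .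
    have "norm (2 * exp (- s) - \<alpha> + \<beta> * exp s) \<le> 2 * norm (exp (- s)) + norm \<alpha> + norm \<beta> * norm (exp s)"
      using norm_triangle_ineq[of "2 * exp (- s) - \<alpha>" "\<beta> * exp s"] norm_triangle_ineq4[of "2 * exp (- s)" \<alpha>] by (simp add: norm_mult)
    also have "\<dots> \<le> 2 * E + norm \<alpha> * E + norm \<beta> * E" using b by (intro add_mono mult_left_mono) (auto simp: mult_le_cancel_left1)
    also have "\<dots> = (2 + norm \<alpha> + norm \<beta>) * E" by (simp add: algebra_simps)
    also have "\<dots> \<le> C * E" using b C by (intro mult_right_mono) auto
    finally have n3: "norm (2 * exp (- s) - \<alpha> + \<beta> * exp s) \<le> C * E" .
    have n4: "norm (x * exp s ^ 2) \<le> C * E" if "norm x \<le> C" for x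
      using b that C unfolding norm_mult by (intro mult_mono) auto
    show "norm (exp (- s)) \<le> C * exp (p * Re s) \<and> norm (\<alpha> - 3 * exp (- s)) \<le> C * exp (p * Re s)
        \<and> norm (2 * exp (- s) - \<alpha> + \<beta> * exp s) \<le> C * exp (p * Re s) \<and> norm (\<gamma> * exp s ^ 2) \<le> C * exp (p * Re s)
        \<and> norm (\<delta> * exp s ^ 2) \<le> C * exp (p * Re s)"
      using n1 n2 n3 n4[of \<gamma>] n4[of \<delta>] C by (simp add: E_def)
  qed
  then obtain C' and n :: nat where bound: "\<And>s. Re s \<ge> 1 \<Longrightarrow> norm (g s) \<le> C' * exp (p * Re s) * Re s ^ n" by blast
  \<comment> \<open>The exponent is rounded up to a natural number, and the logarithmic factor is
    absorbed by \<open>Re s \<le> exp (Re s)\<close>.\<close>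
  define q where "q = nat \<lceil>p\<rceil>"
  have q: "p \<le> q" unfolding q_def by linarith
  have "norm (v z) \<le> \<bar>C'\<bar> * norm z ^ (q + n)" if z: "norm z \<ge> exp 1" for z
  proof -
    have z0: "z \<noteq> 0" using z by (auto simp: not_le)
    define s where "s = Ln z"
    have zs: "exp s = z" using z0 by (simp add: s_def)
    have nz: "norm z = exp (Re s)" by (simp flip: zs)
    have s: "Re s \<ge> 1" using z by (simp add: nz)
    have "norm (v z) \<le> C' * exp (p * Re s) * Re s ^ n" using bound[OF s] by (simp add: g_def zs)
    also have "\<dots> \<le> \<bar>C'\<bar> * exp (q * Re s) * exp (Re s) ^ n"
    proof (intro mult_mono power_mono)
      show "exp (p * Re s) \<le> exp (q * Re s)" using q s by (simp add: mult_right_mono)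
      show "Re s \<le> exp (Re s)" using exp_ge_add_one_self[of "Re s"] by linarith
    qed (use s in auto)
    also have "\<dots> = \<bar>C'\<bar> * norm z ^ (q + n)" by (simp add: nz power_add exp_of_nat_mult)
    finally show ?thesis .
  qed
  thus ?thesis by blast
qed

lemma deriv_eq_off_0:
  fixes f r r' :: "complex \<Rightarrow> complex"
  assumes eq: "\<And>z. z \<noteq> 0 \<Longrightarrow> f z = r z" and r: "\<And>z. z \<noteq> 0 \<Longrightarrow> (r has_field_derivative r' z) (at z)"
    and z: "z \<noteq> 0"
  shows "deriv f z = r' z"
proof (rule DERIV_imp_deriv, rule has_field_derivative_transform_within_open[OF r[OF z]])
  show "open (- {0 :: complex})" by auto
qed (use z eq in auto)

text \<open>If P has degree d with leading coefficient c, the power \<open>z ^ (2 * d - 2)\<close>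
  has coefficient \<open>d * c\<^sup>2 * (d * (A + B) - B)\<close> on the quadratic side, while the
  linear side grows at most like \<open>z ^ d\<close>. For d >= 3 the quadratic side has the higher
  power, so its coefficient would have to vanish.\<close>

lemma ode_rational_degree:
  fixes v :: "complex \<Rightarrow> complex"
  assumes ode: "\<And>z. z \<noteq> 0 \<Longrightarrow> ode_at A B \<alpha> \<beta> \<gamma> \<delta> v z"
    and v: "\<And>z. z \<noteq> 0 \<Longrightarrow> v z = u0 / z + poly P z"
    and poly_degree: "\<And>n::nat. n \<ge> 3 \<Longrightarrow> of_nat n * (A + B) \<noteq> B"
  shows "degree P \<le> 2"
proof (rule ccontr)
  define n where "n = degree P - 3"
  define c where "c = lead_coeff P"
  assume "\<not> degree P \<le> 2"
  hence deg: "degree P = n + 3" by (simp add: n_def)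
  hence "P \<noteq> 0" by auto
  hence c: "c \<noteq> 0" by (simp add: c_def)
  have v1: "deriv v z = - u0 / z ^ 2 + poly (pderiv P) z" if "z \<noteq> 0" for z
    by (rule deriv_eq_off_0[OF v _ that])
       (auto intro!: derivative_eq_intros simp: power2_eq_square field_simps)
  have v2: "deriv (deriv v) z = 2 * u0 / z ^ 3 + poly (pderiv (pderiv P)) z" if "z \<noteq> 0" for z
    by (rule deriv_eq_off_0[OF v1 _ that])
       (auto intro!: derivative_eq_intros simp: power2_eq_square eval_nat_numeral field_simps)
  have v3: "deriv (deriv (deriv v)) z = - 6 * u0 / z ^ 4 + poly (pderiv (pderiv (pderiv P))) z" if "z \<noteq> 0" for z
    by (rule deriv_eq_off_0[OF v2 _ that])
       (auto intro!: derivative_eq_intros simp: power2_eq_square eval_nat_numeral field_simps)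
  have inv: "((\<lambda>z::complex. inverse z) \<longlongrightarrow> 0) at_infinity" by (rule tendsto_inverse_0)
  have nz: "eventually (\<lambda>z::complex. z \<noteq> 0) at_infinity"
    unfolding eventually_at_infinity by (rule exI[of _ 1]) auto
  have lc: "lead_coeff (pderiv Q) = of_nat (degree Q) * lead_coeff Q" if "degree Q \<noteq> 0" for Q :: "complex poly"
    using that by (simp add: degree_pderiv coeff_pderiv flip: of_nat_Suc)
  have d1: "degree (pderiv P) = n + 2" "lead_coeff (pderiv P) = of_nat (n + 3) * c"
    using deg lc[of P] by (simp_all add: degree_pderiv c_def)
  have d2: "degree (pderiv (pderiv P)) = n + 1" "lead_coeff (pderiv (pderiv P)) = of_nat (n + 2) * (of_nat (n + 3) * c)"
    using d1 lc[of "pderiv P"] by (simp_all add: degree_pderiv)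
  have d3: "degree (pderiv (pderiv (pderiv P))) = n"
    using d2 by (simp add: degree_pderiv)
  have lim: "((\<lambda>z. f z / z ^ d) \<longlongrightarrow> e) at_infinity"
    if f: "\<And>z. z \<noteq> 0 \<Longrightarrow> f z = a / z ^ Suc k + poly Q z" and Q: "degree Q = d" "lead_coeff Q = e"
    for f a e k d and Q :: "complex poly"
  proof -
    have "((\<lambda>z. a * inverse z ^ Suc k * inverse z ^ d + poly Q z / z ^ d) \<longlongrightarrow> a * 0 ^ Suc k * 0 ^ d + e) at_infinity"
      using poly_divide_tendsto_aux[of Q] unfolding Q(2)[symmetric] Q(1)[symmetric] by (intro tendsto_intros inv)
    hence "((\<lambda>z. a * inverse z ^ Suc k * inverse z ^ d + poly Q z / z ^ d) \<longlongrightarrow> e) at_infinity"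
      by simp
    moreover have "eventually (\<lambda>z. a * inverse z ^ Suc k * inverse z ^ d + poly Q z / z ^ d = f z / z ^ d) at_infinity"
      using nz
    proof eventually_elim
      case (elim z)
      show ?case unfolding f[OF elim] by (simp only: add_divide_distrib divide_inverse power_inverse ring_distribs)
    qed
    ultimately show ?thesis by (rule Lim_transform_eventually)
  qed
  have l0: "((\<lambda>z. v z / z ^ (n + 3)) \<longlongrightarrow> c) at_infinity"
    by (rule lim[of _ u0 0 P]) (simp_all add: v deg c_def)
  have l1: "((\<lambda>z. deriv v z / z ^ (n + 2)) \<longlongrightarrow> of_nat (n + 3) * c) at_infinity"
    by (rule lim[of _ "- u0" 1 "pderiv P", OF _ d1]) (simp add: v1 power2_eq_square)
  have l2: "((\<lambda>z. deriv (deriv v) z / z ^ (n + 1)) \<longlongrightarrow> of_nat (n + 2) * (of_nat (n + 3) * c)) at_infinity"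
    by (rule lim[of _ "2 * u0" 2 "pderiv (pderiv P)", OF _ d2]) (simp add: v2 power2_eq_square power3_eq_cube)
  have l3: "((\<lambda>z. deriv (deriv (deriv v)) z / z ^ n) \<longlongrightarrow> lead_coeff (pderiv (pderiv (pderiv P)))) at_infinity"
    by (rule lim[of _ "- 6 * u0" 3 "pderiv (pderiv (pderiv P))", OF _ d3 refl]) (simp add: v3 eval_nat_numeral)
  \<comment> \<open>\<open>L\<close> and \<open>R\<close> are the two sides of the equation divided
    by \<open>z ^ (2 * n + 4)\<close>, arranged so that their limits at infinity can be read off
    factor by factor.\<close>
  define L where "L z = A * (deriv v z / z ^ (n + 2))\<^sup>2 + B * (v z / z ^ (n + 3)) * (deriv (deriv v) z / z ^ (n + 1))" for z
  define R where "R z = (deriv (deriv (deriv v)) z / z ^ n) * inverse z ^ (n + 4) + \<alpha> * (deriv (deriv v) z / z ^ (n + 1)) * inverse z ^ (n + 3)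
    + \<beta> * (deriv v z / z ^ (n + 2)) * inverse z ^ (n + 2) + \<gamma> * (v z / z ^ (n + 3)) * inverse z ^ (n + 1) + \<delta> * inverse z ^ (2 * n + 4)" for z
  have "(L \<longlongrightarrow> A * (of_nat (n + 3) * c)\<^sup>2 + B * c * (of_nat (n + 2) * (of_nat (n + 3) * c))) at_infinity"
    unfolding L_def by (intro tendsto_intros l0 l1 l2)
  moreover have "(R \<longlongrightarrow> lead_coeff (pderiv (pderiv (pderiv P))) * 0 ^ (n + 4) + \<alpha> * (of_nat (n + 2) * (of_nat (n + 3) * c)) * 0 ^ (n + 3)
      + \<beta> * (of_nat (n + 3) * c) * 0 ^ (n + 2) + \<gamma> * c * 0 ^ (n + 1) + \<delta> * 0 ^ (2 * n + 4)) at_infinity"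
    unfolding R_def by (intro tendsto_intros l0 l1 l2 l3 inv)
  hence "(R \<longlongrightarrow> 0) at_infinity" by (simp add: power_0_left)
  moreover have "eventually (\<lambda>z. R z = L z) at_infinity"
    using nz
  proof eventually_elim
    case (elim z)
    define y M where "y = inverse z" and "M = y ^ (2 * n + 4)"
    have M: "y ^ (n + 2) * y ^ (n + 2) = M" "y ^ (n + 3) * y ^ (n + 1) = M" "y ^ n * y ^ (n + 4) = M"
      unfolding M_def power_add[symmetric] by (rule arg_cong[of _ _ "power y"], simp)+
    have quot: "x / z ^ k = x * y ^ k" for x and k :: nat by (simp add: y_def divide_inverse power_inverse)
    have "L z = (A * (deriv v z)\<^sup>2 + B * v z * deriv (deriv v) z) * M"
    proof -
      have "A * (d1 * a)\<^sup>2 + B * (w * b) * (d2 * b') = (A * d1\<^sup>2 + B * w * d2) * M"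
        if "a * a = M" "b * b' = M" for a b b' w d1 d2
      proof -
        have "A * (d1 * a)\<^sup>2 + B * (w * b) * (d2 * b') = A * d1\<^sup>2 * (a * a) + B * w * d2 * (b * b')"
          by (simp add: power2_eq_square mult_ac)
        thus ?thesis by (simp only: that ring_distribs)
      qed
      thus ?thesis unfolding L_def quot using M(1,2) by blast
    qed
    also have "\<dots> = (deriv (deriv (deriv v)) z + \<alpha> * deriv (deriv v) z + \<beta> * deriv v z + \<gamma> * v z + \<delta>) * M"
      using ode[OF elim] by (simp only: ode_at_def)
    also have "\<dots> = R z"
    proof -
      have "(d3 + \<alpha> * d2 + \<beta> * d1 + \<gamma> * w + \<delta>) * M
          = (d3 * e) * e' + \<alpha> * (d2 * b') * b + \<beta> * (d1 * a) * a + \<gamma> * (w * b) * b' + \<delta> * M"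
        if "a * a = M" "b * b' = M" "e * e' = M" for a b b' e e' w d1 d2 d3
      proof -
        have "(d3 * e) * e' + \<alpha> * (d2 * b') * b + \<beta> * (d1 * a) * a + \<gamma> * (w * b) * b' + \<delta> * M
            = d3 * (e * e') + \<alpha> * d2 * (b * b') + \<beta> * d1 * (a * a) + \<gamma> * w * (b * b') + \<delta> * M"
          by (simp add: mult_ac)
        thus ?thesis by (simp only: that ring_distribs)
      qed
      thus ?thesis unfolding R_def quot y_def[symmetric] M_def[symmetric] using M by blast
    qed
    finally show ?case by simp
  qed
  ultimately have "A * (of_nat (n + 3) * c)\<^sup>2 + B * c * (of_nat (n + 2) * (of_nat (n + 3) * c)) = 0"
    using Lim_transform_eventually[of R 0 at_infinity L] tendsto_unique[OF trivial_limit_at_infinity] by blast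
  hence "(of_nat (n + 3) * c\<^sup>2) * (of_nat (n + 3) * (A + B) - B) = 0"
    by (simp add: power2_eq_square algebra_simps)
  moreover have "of_nat (n + 3) * c\<^sup>2 \<noteq> 0" using c by (simp del: of_nat_add)
  moreover have "y = 0" if "x * y = 0" "x \<noteq> 0" for x y :: complex using that by simp
  ultimately have "of_nat (n + 3) * (A + B) - B = 0" by blast
  thus False using poly_degree[of "n + 3"] by simp
qed

lemma ode_solution_rational:
  assumes sol: "ode_solution A B \<alpha> \<beta> \<gamma> \<delta> v" and AB: "A + B \<noteq> 0"
    and pole_order: "\<And>n::nat. n \<ge> 2 \<Longrightarrow> of_nat n * (A + B) + B \<noteq> 0"
    and poly_degree: "\<And>n::nat. n \<ge> 3 \<Longrightarrow> of_nat n * (A + B) \<noteq> B"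
    and indices: "\<And>n::nat. A + 2 * B \<noteq> 0 \<Longrightarrow> n \<ge> 1 \<Longrightarrow> (A + 2 * B) * of_nat n ^ 2 - (7 * A + 8 * B) * of_nat n + 6 * (A + 2 * B) \<noteq> 0"
    and poles: "\<And>z. is_pole v z \<Longrightarrow> z = 0"
  obtains u0 P where "degree P \<le> 2" "\<And>z. \<not> is_pole v z \<Longrightarrow> v z = u0 / z + poly P z"
proof -
  have nice: "v nicely_meromorphic_on UNIV" using sol by (simp add: ode_solution_def)
  hence mero: "v meromorphic_on UNIV" by (simp add: nicely_meromorphic_on_def)
  have an: "v analytic_on {z}" if "\<not> is_pole v z" for z
    using nicely_meromorphic_on_imp_analytic_at[OF nice] that by simp
  \<comment> \<open>If 0 is no pole, then \<open>u0 = 0\<close> and the quotient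
    \<open>u0 / z\<close> is 0 even at \<open>z = 0\<close>, so one formula serves both
    cases.\<close>
  define u0 where "u0 = (if is_pole v 0 then residue v 0 else 0)"
  define w where "w = (\<lambda>z. u0 / z)"
  have w: "w analytic_on {z}" if "z \<noteq> 0 \<or> u0 = 0" for z
    using that by (cases "u0 = 0") (simp_all add: w_def, auto intro!: analytic_intros)
  have wm: "w meromorphic_on UNIV" unfolding w_def by (intro meromorphic_intros)
  have "\<exists>\<rho>. (\<lambda>h. h * v (z + h)) \<midarrow>0\<rightarrow> \<rho> \<and> (\<lambda>h. h * w (z + h)) \<midarrow>0\<rightarrow> \<rho>"
    if "is_pole v z \<or> is_pole w z" for z
  proof -
    note that
    moreover have "z = 0 \<and> u0 \<noteq> 0" if "is_pole w z"
      using w[of z] that analytic_at_imp_no_pole by blast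
    ultimately have z: "z = 0" "is_pole v 0" using poles[of z] by (auto simp: u0_def split: if_splits)
    have "(\<lambda>h. h * v (0 + h)) \<midarrow>0\<rightarrow> residue v 0"
      using ode_solution_poles(3)[OF sol pole_order indices z(2)] .
    moreover have "(\<lambda>h. h * w (0 + h)) \<midarrow>0\<rightarrow> u0"
      by (rule tendsto_eventually) (auto simp: w_def eventually_at_filter)
    ultimately show ?thesis using z by (auto simp: u0_def)
  qed
  then obtain f where f: "f holomorphic_on UNIV" "\<And>z. v analytic_on {z} \<Longrightarrow> w analytic_on {z} \<Longrightarrow> f z = v z - w z"
    using entire_difference[OF mero wm] by blast
  have f_eq: "f z = v z - u0 / z" if "\<not> is_pole v z" for z
  proof (cases "z = 0")
    case True
    hence "u0 = 0" using that by (simp add: u0_def)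
    thus ?thesis using f(2)[OF an[OF that] w] by (simp add: w_def)
  next
    case False
    thus ?thesis using f(2)[OF an[OF that] w] by (simp add: w_def)
  qed
  obtain C and n :: nat where growth: "\<And>z. norm z \<ge> exp 1 \<Longrightarrow> norm (v z) \<le> C * norm z ^ n"
    using ode_solution_growth[OF sol AB poles] by blast
  have "norm (f z) \<le> (C + norm u0) * norm z ^ n" if z: "exp 1 \<le> norm z" for z
  proof -
    have z1: "norm z \<ge> 1" using z by (meson one_le_exp_iff order_trans zero_le_one)
    hence "\<not> is_pole v z" using poles[of z] by auto
    hence "norm (f z) \<le> norm (v z) + norm u0 / norm z"
      using norm_triangle_ineq4[of "v z" "u0 / z"] by (simp add: f_eq norm_divide)
    also have "norm u0 / norm z \<le> norm u0 / 1" using z1 by (intro divide_left_mono) auto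
    also have "norm u0 / 1 \<le> norm u0 * norm z ^ n" using z1 by (simp add: mult_le_cancel_left1 one_le_power)
    also note growth[OF z]
    finally show ?thesis by (simp add: algebra_simps)
  qed
  hence liou: "f z = (\<Sum>k\<le>n. (deriv ^^ k) f 0 / fact k * z ^ k)" for z
    by (intro Liouville_polynomial[OF f(1)])
  define P where "P = (\<Sum>k\<le>n. monom ((deriv ^^ k) f 0 / fact k) k)"
  have P: "poly P z = f z" for z by (subst liou) (simp add: P_def poly_sum poly_monom)
  have v: "v z = u0 / z + poly P z" if "\<not> is_pole v z" for z
    using f_eq[OF that] by (simp add: P)
  moreover have "degree P \<le> 2"
  proof (rule ode_rational_degree[OF _ _ poly_degree])
    show "ode_at A B \<alpha> \<beta> \<gamma> \<delta> v z" "v z = u0 / z + poly P z" if "z \<noteq> 0" for z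
      using that poles[of z] sol v[of z] by (auto simp: ode_solution_def)
  qed
  ultimately show ?thesis using that by blast
qed

subsection \<open>Solutions with several poles\<close>

lemma nicely_meromorphic_poles_discrete:
  assumes "g nicely_meromorphic_on UNIV"
  shows "countable {z. is_pole g z}" and "compact K \<Longrightarrow> finite (K \<inter> {z. is_pole g z})"
proof -
  have "{w. \<not> g analytic_on {w}} sparse_in UNIV"
    using assms by (intro meromorphic_on_imp_sparse_singularities) (simp add: nicely_meromorphic_on_def)
  hence sparse: "{z. is_pole g z} sparse_in UNIV"
    by (rule sparse_in_subset2) (use analytic_at_imp_no_pole in blast)
  show "countable {z. is_pole g z}"
    using sparse_imp_countable[OF open_UNIV sparse] by simp
  show "finite (K \<inter> {z. is_pole g z})" if "compact K"
    using sparse_in_compact_finite[OF sparse_in_subset[OF sparse subset_UNIV] that] .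
qed

lemma avoid_countable:
  fixes a b :: real
  assumes "countable Q" "a < b"
  obtains x where "a < x" "x < b" "x \<notin> Q"
proof -
  have "uncountable ({a<..<b} - Q)"
    using assms by (intro uncountable_minus_countable) (simp_all add: uncountable_open_interval)
  hence "{a<..<b} - Q \<noteq> {}" using countable_empty by metis
  then obtain x where "x \<in> {a<..<b} - Q" by blast
  thus ?thesis using that[of x] by simp
qed

section \<open>Contour integrals over period rectangles\<close>

lemma contour_integral_linepath_translate:
  assumes "\<And>s. f (s + c) = f s"
  shows "contour_integral (linepath (a + c) (b + c)) f = contour_integral (linepath a b) f"
proof -
  have "linepath (a + c) (b + c) x = linepath a b x + c" for x :: real
    by (simp add: linepath_def algebra_simps)
  thus ?thesis by (simp add: contour_integral_integral assms)
qed

text \<open>An integral over a full period does not depend on its starting point. This is needed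
  because the second period may be oblique: it maps the left edge of a rectangle to its right edge
  only up to a vertical slide.\<close>

lemma contour_integral_vertical_period:
  assumes per: "\<And>s. f (s + 2 * pi * \<i>) = f s" and t: "0 \<le> t" "t \<le> 2 * pi"
    and cont: "continuous_on {s. Re s = Re a} f"
  shows "contour_integral (linepath (a - t * \<i>) (a - t * \<i> + 2 * pi * \<i>)) f
    = contour_integral (linepath a (a + 2 * pi * \<i>)) f"
proof -
  define b where "b = a - t * \<i>"
  have seg: "continuous_on (closed_segment x y) f" if "Re x = Re a" "Re y = Re a" for x y
    by (rule continuous_on_subset[OF cont])
       (use that in \<open>auto simp: closed_segment_same_Re\<close>)
  have "a \<in> closed_segment b (b + 2 * pi * \<i>)"
    using t by (simp add: b_def closed_segment_same_Re closed_segment_eq_real_ivl)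
  hence 1: "contour_integral (linepath b (b + 2 * pi * \<i>)) f
      = contour_integral (linepath b a) f + contour_integral (linepath a (b + 2 * pi * \<i>)) f"
    by (intro contour_integral_split_linepath seg) (simp_all add: b_def)
  have "b + 2 * pi * \<i> \<in> closed_segment a (a + 2 * pi * \<i>)"
    using t by (simp add: b_def closed_segment_same_Re closed_segment_eq_real_ivl)
  hence 2: "contour_integral (linepath a (a + 2 * pi * \<i>)) f
      = contour_integral (linepath a (b + 2 * pi * \<i>)) f + contour_integral (linepath (b + 2 * pi * \<i>) (a + 2 * pi * \<i>)) f"
    by (intro contour_integral_split_linepath seg) (simp_all add: b_def)
  have "contour_integral (linepath (b + 2 * pi * \<i>) (a + 2 * pi * \<i>)) f = contour_integral (linepath b a) f"
    by (rule contour_integral_linepath_translate[of f, OF per])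
  thus ?thesis using 1 2 by (simp add: b_def[symmetric])
qed

text \<open>A rectangle replaces the slanted period parallelogram, since its winding numbers are
  explicit. The horizontal edges cancel by the period \<open>2 * pi * \<i>\<close>; the vertical
  ones cancel by \<open>\<omega>\<close> followed by a slide of length
  \<open>Im \<omega>\<close>.\<close>

lemma contour_integral_doubly_periodic_rectpath:
  assumes per1: "\<And>s. f (s + 2 * pi * \<i>) = f s" and per2: "\<And>s. f (s + \<omega>) = f s"
    and omega: "Re \<omega> > 0" "0 \<le> Im \<omega>" "Im \<omega> \<le> 2 * pi"
    and cont: "continuous_on {s. Re s \<in> {x, x + Re \<omega>} \<or> Im s \<in> {y, y + 2 * pi}} f"
  shows "contour_integral (rectpath (Complex x y) (Complex (x + Re \<omega>) (y + 2 * pi))) f = 0"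
proof -
  define a1 a2 a3 a4 where "a1 = Complex x y" and "a2 = Complex (x + Re \<omega>) y"
    and "a3 = Complex (x + Re \<omega>) (y + 2 * pi)" and "a4 = Complex x (y + 2 * pi)"
  note defs = a1_def a2_def a3_def a4_def
  have segRe: "continuous_on (closed_segment p q) f" if "Re p = Re q" "Re p \<in> {x, x + Re \<omega>}" for p q
    by (rule continuous_on_subset[OF cont]) (use that in \<open>auto simp: closed_segment_same_Re\<close>)
  have segIm: "continuous_on (closed_segment p q) f" if "Im p = Im q" "Im p \<in> {y, y + 2 * pi}" for p q
    by (rule continuous_on_subset[OF cont]) (use that in \<open>auto simp: closed_segment_same_Im\<close>)
  have int: "f contour_integrable_on linepath a1 a2" "f contour_integrable_on linepath a2 a3"
    "f contour_integrable_on linepath a3 a4" "f contour_integrable_on linepath a4 a1"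
    by (intro contour_integrable_continuous_linepath segRe segIm; simp add: defs)+
  have "rectpath a1 a3 = linepath a1 a2 +++ linepath a2 a3 +++ linepath a3 a4 +++ linepath a4 a1"
    by (simp add: rectpath_def Let_def defs)
  hence "contour_integral (rectpath a1 a3) f = contour_integral (linepath a1 a2) f + (contour_integral (linepath a2 a3) f
      + (contour_integral (linepath a3 a4) f + contour_integral (linepath a4 a1) f))"
    using int by (simp add: contour_integrable_join)
  moreover have "contour_integral (linepath a3 a4) f = - contour_integral (linepath a4 a3) f"
    by (intro contour_integral_reverse_linepath segIm) (simp_all add: defs)
  moreover have "contour_integral (linepath a4 a3) f = contour_integral (linepath a1 a2) f"
  proof -
    have "a4 = a1 + 2 * pi * \<i>" "a3 = a2 + 2 * pi * \<i>" by (simp_all add: defs complex_eq_iff)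
    thus ?thesis using contour_integral_linepath_translate[of f, OF per1, of a1 a2] by simp
  qed
  moreover have "contour_integral (linepath a4 a1) f = - contour_integral (linepath a1 a4) f"
    by (intro contour_integral_reverse_linepath segRe) (simp_all add: defs)
  moreover have "contour_integral (linepath a2 a3) f = contour_integral (linepath a1 a4) f"
  proof -
    have eq: "a2 = (a1 - Im \<omega> * \<i>) + \<omega>" "a3 = (a1 - Im \<omega> * \<i> + 2 * pi * \<i>) + \<omega>" "a4 = a1 + 2 * pi * \<i>"
      by (simp_all add: defs complex_eq_iff)
    have "contour_integral (linepath a2 a3) f = contour_integral (linepath (a1 - Im \<omega> * \<i>) (a1 - Im \<omega> * \<i> + 2 * pi * \<i>)) f"
      unfolding eq(1,2) by (rule contour_integral_linepath_translate[of f, OF per2])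
    also have "\<dots> = contour_integral (linepath a1 (a1 + 2 * pi * \<i>)) f"
      by (rule contour_integral_vertical_period[of f, OF per1 omega(2,3)])
         (rule continuous_on_subset[OF cont], auto simp: defs)
    finally show ?thesis using eq(3) by simp
  qed
  ultimately show ?thesis by (simp add: defs)
qed

lemma periodic_of_int_mult:
  fixes g :: "complex \<Rightarrow> complex"
  assumes per: "\<And>s. g (s + c) = g s"
  shows "g (s + of_int k * c) = g s"
proof (induction k rule: int_induct[where k = 0])
  case (step1 i)
  thus ?case using per[of "s + of_int i * c"] by (simp add: algebra_simps)
next
  case (step2 i)
  thus ?case using per[of "s + of_int (i - 1) * c"] by (simp add: algebra_simps)
qed simp

text \<open>All residues being equal, they cannot cancel in a period parallelogram.\<close>
lemma no_second_period:
  assumes nice: "g nicely_meromorphic_on UNIV"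
    and per1: "\<And>s. g (s + 2 * pi * \<i>) = g s" and per2: "\<And>s. g (s + \<omega>) = g s"
    and omega: "Re \<omega> \<noteq> 0"
    and pole: "is_pole g 0" and res: "\<And>z. is_pole g z \<Longrightarrow> residue g z = \<rho>" and rho: "\<rho> \<noteq> 0"
  shows False
proof -
  \<comment> \<open>Sign and imaginary part of the second period are normalised: the sign here, and
    in \<open>\<omega>2\<close> the imaginary part modulo \<open>2 * pi\<close>, as the slide along
    the vertical edge requires.\<close>
  define \<omega>1 where "\<omega>1 = (if Re \<omega> > 0 then \<omega> else - \<omega>)"
  have per_w1: "g (s + \<omega>1) = g s" for s
    using per2[of s] per2[of "s - \<omega>"] by (simp add: \<omega>1_def)
  define \<omega>2 where "\<omega>2 = \<omega>1 + of_int (- \<lfloor>Im \<omega>1 / (2 * pi)\<rfloor>) * (2 * pi * \<i>)"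
  have per_w2: "g (s + \<omega>2) = g s" for s
    unfolding \<omega>2_def add.assoc[symmetric]
    using periodic_of_int_mult[of g, OF per1, of "s + \<omega>1" "- \<lfloor>Im \<omega>1 / (2 * pi)\<rfloor>"] per_w1[of s]
    by (simp only:)
  have w2: "Re \<omega>2 > 0" using omega by (auto simp: \<omega>2_def \<omega>1_def)
  have "Im \<omega>2 = frac (Im \<omega>1 / (2 * pi)) * (2 * pi)" by (simp add: \<omega>2_def frac_def algebra_simps)
  hence w2': "0 \<le> Im \<omega>2" "Im \<omega>2 \<le> 2 * pi"
    using frac_ge_0[of "Im \<omega>1 / (2 * pi)"] frac_lt_1[of "Im \<omega>1 / (2 * pi)"] by (simp_all add: mult_le_cancel_right2 del: frac_ge_0)
  define Q where "Q = {z. is_pole g z}"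
  have Q: "countable Q" "\<And>K. compact K \<Longrightarrow> finite (K \<inter> Q)"
    using nicely_meromorphic_poles_discrete[OF nice] by (auto simp: Q_def)
  have shift: "is_pole g (z + c) \<longleftrightarrow> is_pole g z" if "\<And>s. g (s + c) = g s" for z c
    using is_pole_affine[of 1 g c z] that by simp
  \<comment> \<open>The rectangle must contain 0 but have no pole on its edges. Countability of the
    poles permits this, and by periodicity it suffices to avoid them on the left and lower
    edges.\<close>
  obtain x where x: "- Re \<omega>2 < x" "x < 0" "x \<notin> Re ` Q"
    using avoid_countable[of "Re ` Q" "- Re \<omega>2" 0] Q w2 by auto
  obtain y where y: "- (2 * pi) < y" "y < 0" "y \<notin> Im ` Q"
    using avoid_countable[of "Im ` Q" "- (2 * pi)" 0] Q by auto
  have off: "z \<notin> Q" if "Re z \<in> {x, x + Re \<omega>2} \<or> Im z \<in> {y, y + 2 * pi}" for z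
  proof
    assume z: "z \<in> Q"
    hence "z - \<omega>2 \<in> Q" "z - 2 * pi * \<i> \<in> Q"
      using shift[OF per_w2, of "z - \<omega>2"] shift[OF per1, of "z - 2 * pi * \<i>"] by (simp_all add: Q_def)
    hence "Re z \<in> Re ` Q" "Re z - Re \<omega>2 \<in> Re ` Q" "Im z \<in> Im ` Q" "Im z - 2 * pi \<in> Im ` Q"
      using z by (force simp: image_iff)+
    moreover have "x \<in> {Re z, Re z - Re \<omega>2} \<or> y \<in> {Im z, Im z - 2 * pi}" using that by auto
    ultimately show False using x(3) y(3) by (metis insert_iff empty_iff)
  qed
  define a1 a3 where "a1 = Complex x y" and "a3 = Complex (x + Re \<omega>2) (y + 2 * pi)"
  have hol: "g holomorphic_on - Q" "open (- Q)"
    using nicely_meromorphic_holomorphic_compl_poles[OF nice] by (simp_all add: Q_def Compl_eq)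
  have "contour_integral (rectpath a1 a3) g = 0"
    unfolding a1_def a3_def
  proof (rule contour_integral_doubly_periodic_rectpath[OF per1 per_w2 w2 w2'])
    show "continuous_on {s. Re s \<in> {x, x + Re \<omega>2} \<or> Im s \<in> {y, y + 2 * pi}} g"
      by (rule continuous_on_subset[OF holomorphic_on_imp_continuous_on[OF hol(1)]]) (use off in auto)
  qed
  have "bounded (cbox a1 a3)" by (rule bounded_cbox)
  then obtain r where r: "cbox a1 a3 \<subseteq> ball 0 r" by (meson bounded_subset_ballD)
  define pts where "pts = ball 0 r \<inter> Q"
  have fin: "finite pts" unfolding pts_def
    by (rule finite_subset[OF _ Q(2)[OF compact_cball[of 0 r]]]) auto
  have le: "Re a1 \<le> Re a3" "Im a1 \<le> Im a3" using w2 by (simp_all add: a1_def a3_def)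
  have path: "path_image (rectpath a1 a3) \<subseteq> ball 0 r - pts"
  proof -
    have "path_image (rectpath a1 a3) \<subseteq> cbox a1 a3" by (rule path_image_rectpath_subset_cbox[OF le])
    moreover have "path_image (rectpath a1 a3) \<inter> Q = {}"
      unfolding path_image_rectpath[OF le] using off by (auto simp: a1_def a3_def)
    ultimately show ?thesis using r by (auto simp: pts_def)
  qed
  have "contour_integral (rectpath a1 a3) g = 2 * pi * \<i> * (\<Sum>p\<in>pts. winding_number (rectpath a1 a3) p * residue g p)"
  proof (rule Residue_theorem[where S = "ball 0 r"])
    show "g holomorphic_on ball 0 r - pts"
      by (rule holomorphic_on_subset[OF hol(1)]) (auto simp: pts_def)
    show "\<forall>z. z \<notin> ball 0 r \<longrightarrow> winding_number (rectpath a1 a3) z = 0"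
      using r by (auto intro!: winding_number_rectpath_outside[OF le])
  qed (use fin path in auto)
  also have "(\<Sum>p\<in>pts. winding_number (rectpath a1 a3) p * residue g p) = (\<Sum>p\<in>pts. of_bool (p \<in> box a1 a3) * \<rho>)"
  proof (rule sum.cong)
    fix p assume p: "p \<in> pts"
    have "p \<notin> path_image (rectpath a1 a3)" using path p by auto
    hence "p \<in> box a1 a3 \<or> p \<notin> cbox a1 a3"
      unfolding path_image_rectpath_cbox_minus_box[OF le] by blast
    moreover have "box a1 a3 \<subseteq> cbox a1 a3" by (rule box_subset_cbox)
    ultimately have "winding_number (rectpath a1 a3) p = of_bool (p \<in> box a1 a3)"
      using winding_number_rectpath winding_number_rectpath_outside[OF le] by auto
    moreover have "residue g p = \<rho>" using p by (intro res) (simp add: pts_def Q_def)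
    ultimately show "winding_number (rectpath a1 a3) p * residue g p = of_bool (p \<in> box a1 a3) * \<rho>" by simp
  qed simp
  \<comment> \<open>All enclosed residues being \<open>\<rho>\<close>, the integral counts the poles
    inside. It is zero, yet the pole at 0 is counted.\<close>
  also have "\<dots> = of_nat (card (pts \<inter> box a1 a3)) * \<rho>"
    using fin by (simp add: sum_distrib_right[symmetric] of_bool_def sum.If_cases Int_def)
  finally have "card (pts \<inter> box a1 a3) = 0"
    using \<open>contour_integral (rectpath a1 a3) g = 0\<close> rho by simp
  moreover have "0 \<in> pts \<inter> box a1 a3"
  proof -
    have "0 \<in> box a1 a3" using x y by (simp add: a1_def a3_def in_box_complex_iff)
    moreover have "box a1 a3 \<subseteq> ball 0 r" using r box_subset_cbox by blast
    ultimately show ?thesis using pole by (auto simp: pts_def Q_def)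
  qed
  ultimately show False using fin by auto
qed

section \<open>Growth and classification of periodic solutions\<close>

lemma periodic_ode_growth:
  assumes sol: "ode_solution A B \<alpha> \<beta> \<gamma> \<delta> g" and AB: "A + B \<noteq> 0"
    and per: "\<And>s. g (s + 2 * pi * \<i>) = g s"
    and poles: "\<And>s. is_pole g s \<Longrightarrow> Re s \<le> 0"
  shows "\<exists>C (n::nat). \<forall>s. Re s \<ge> 1 \<longrightarrow> norm (g s) \<le> C * Re s ^ n"
proof -
  have nice: "g nicely_meromorphic_on UNIV" using sol by (simp add: ode_solution_def)
  define C where "C = max 1 (max (norm \<alpha>) (max (norm \<beta>) (max (norm \<gamma>) (norm \<delta>))))"
  \<comment> \<open>The coefficients are constant and there is no term with \<open>E\<close>, so
    \<open>p = 0\<close> is possible. The rate \<open>K\<close> is then only known to be positive,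
    which is where the summand \<open>1 / K\<^sup>2\<close> of the estimate matters.\<close>
  have "\<exists>C (n::nat). \<forall>s. Re s \<ge> 1 \<longrightarrow> norm (g s) \<le> C * exp (0 * Re s) * Re s ^ n"
  proof (rule quadratic_ode_growth[where A = A and B = B and E = 0 and C = C
        and ?c3.0 = "\<lambda>_. 1" and ?c2.0 = "\<lambda>_. \<alpha>" and ?c1.0 = "\<lambda>_. \<beta>" and ?c0.0 = "\<lambda>_. \<gamma>" and c = "\<lambda>_. \<delta>"])
    show "g holomorphic_on {s. Re s > 0}"
      by (rule holomorphic_on_subset[OF nicely_meromorphic_holomorphic_compl_poles(2)[OF nice]])
         (use poles in force)
    fix s :: complex assume "Re s > 0"
    hence "\<not> is_pole g s" using poles[of s] by auto
    hence "ode_at A B \<alpha> \<beta> \<gamma> \<delta> g s" using sol by (simp add: ode_solution_def)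
    thus "A * (deriv g s)\<^sup>2 + B * g s * (deriv ^^ 2) g s = 0 * g s * deriv g s
        + 1 * (deriv ^^ 3) g s + \<alpha> * (deriv ^^ 2) g s + \<beta> * deriv g s + \<gamma> * g s + \<delta>"
      by (simp add: ode_at_def numeral_2_eq_2 numeral_3_eq_3)
  qed (use AB per in \<open>auto simp: C_def\<close>)
  thus ?thesis by simp
qed

lemma exp_eq_1_iff_of_int: "exp s = 1 \<longleftrightarrow> (\<exists>k::int. s = of_int k * (2 * pi * \<i>))"
  using exp_eq_1[of s] by (auto simp: complex_eq_iff mult_ac)

text \<open>Inside the strip \<open>\<bar>Re s\<bar> \<le> 1\<close> periodicity gives a bound, so
  the growth is polynomial everywhere and \<open>f\<close> is a polynomial; it takes the value
  \<open>f 0\<close> at all multiples of the period.\<close>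

lemma periodic_entire_poly_growth_const:
  fixes f :: "complex \<Rightarrow> complex"
  assumes f: "f holomorphic_on UNIV" and per: "\<And>s. f (s + 2 * pi * \<i>) = f s"
    and growth: "\<And>s. 1 \<le> \<bar>Re s\<bar> \<Longrightarrow> norm (f s) \<le> C * norm s ^ n"
  shows "f s = f 0"
proof -
  have "bounded (f ` cbox (Complex (- 1) 0) (Complex 1 (2 * pi)))"
    by (intro compact_imp_bounded compact_continuous_image compact_cbox
          continuous_on_subset[OF holomorphic_on_imp_continuous_on[OF f]]) auto
  then obtain M where M: "M > 0" "\<And>s. s \<in> cbox (Complex (- 1) 0) (Complex 1 (2 * pi)) \<Longrightarrow> norm (f s) \<le> M"
    unfolding bounded_pos by blast
  have strip: "norm (f s) \<le> M" if "\<bar>Re s\<bar> \<le> 1" for s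
  proof -
    \<comment> \<open>The shift by 2 moves the strip into the right half-plane, where
      \<open>periodic_representative\<close> applies.\<close>
    have per': "f (t + 2 * pi * \<i> - 2) = f (t - 2)" for t
      using per[of "t - 2"] by (simp add: algebra_simps)
    have "Re (s + 2) > 0" using that by simp
    from periodic_representative[of "\<lambda>t. f (t - 2)", OF per' this]
    obtain s' where s': "Re s' = Re (s + 2)" "0 \<le> Im s'" "Im s' \<le> 2 * pi" "f (s' - 2) = f s" by auto
    hence "norm (f (s' - 2)) \<le> M" using that by (intro M(2)) (auto simp: in_cbox_complex_iff)
    thus ?thesis using s' by simp
  qed
  have "norm (f s) \<le> (\<bar>C\<bar> + M) * norm s ^ n" if "1 \<le> norm s" for s
  proof (cases "1 \<le> \<bar>Re s\<bar>")
    case True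
    have "norm (f s) \<le> C * norm s ^ n" by (rule growth[OF True])
    also have "\<dots> \<le> (\<bar>C\<bar> + M) * norm s ^ n" using M by (intro mult_right_mono) auto
    finally show ?thesis .
  next
    case False
    hence "norm (f s) \<le> M" by (intro strip) simp
    also have "\<dots> \<le> (\<bar>C\<bar> + M) * 1" by simp
    also have "\<dots> \<le> (\<bar>C\<bar> + M) * norm s ^ n" using M that by (intro mult_left_mono one_le_power) auto
    finally show ?thesis .
  qed
  hence liou: "f z = (\<Sum>k\<le>n. (deriv ^^ k) f 0 / fact k * z ^ k)" for z
    by (intro Liouville_polynomial[OF f])
  define P where "P = (\<Sum>k\<le>n. monom ((deriv ^^ k) f 0 / fact k) k) - [:f 0:]"
  have P: "poly P z = f z - f 0" for z by (subst liou) (simp add: P_def poly_sum poly_monom)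
  have "P = 0"
  proof (rule ccontr)
    assume "P \<noteq> 0"
    hence "finite {z. poly P z = 0}" by (rule poly_roots_finite)
    moreover have "range (\<lambda>k::int. of_int k * (2 * pi * \<i>)) \<subseteq> {z. poly P z = 0}"
      using periodic_of_int_mult[of f "2 * pi * \<i>" 0, OF per] by (auto simp: P)
    ultimately have "finite (range (\<lambda>k::int. of_int k * (2 * pi * \<i>)))" by (rule finite_subset[rotated])
    moreover have "inj (\<lambda>k::int. of_int k * (2 * pi * \<i>) :: complex)" by (auto simp: inj_on_def)
    ultimately show False using finite_imageD infinite_UNIV_int by blast
  qed
  thus ?thesis using P[of s] by simp
qed

text \<open>The comparison function \<open>\<rho> / (exp s - 1)\<close> has the same simple poles
  and residues and is bounded for \<open>\<bar>Re s\<bar> \<ge> 1\<close>. The difference is entire,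
  periodic and of polynomial growth, hence constant.\<close>

lemma periodic_ode_solution:
  assumes sol: "ode_solution A B \<alpha> \<beta> \<gamma> \<delta> g" and AB: "A + B \<noteq> 0"
    and per: "\<And>s. g (s + 2 * pi * \<i>) = g s"
    and poles: "\<And>s. is_pole g s \<longleftrightarrow> exp s = 1"
    and res: "\<And>s. is_pole g s \<Longrightarrow> (\<lambda>h. h * g (s + h)) \<midarrow>0\<rightarrow> \<rho>"
  obtains c0 where "\<And>s. exp s \<noteq> 1 \<Longrightarrow> g s = \<rho> / (exp s - 1) + c0"
proof -
  have nice: "g nicely_meromorphic_on UNIV" using sol by (simp add: ode_solution_def)
  hence mero: "g meromorphic_on UNIV" by (simp add: nicely_meromorphic_on_def)
  have an: "g analytic_on {s}" if "exp s \<noteq> 1" for s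
    using nicely_meromorphic_on_imp_analytic_at[OF nice] that poles by simp
  define w where "w = (\<lambda>s::complex. \<rho> / (exp s - 1))"
  have w: "w analytic_on {s}" if "exp s \<noteq> 1" for s
    using that unfolding w_def by (auto intro!: analytic_intros)
  have wm: "w meromorphic_on UNIV" unfolding w_def
    by (intro meromorphic_intros analytic_on_imp_meromorphic_on analytic_intros)
  have "\<exists>\<rho>. (\<lambda>h. h * g (s + h)) \<midarrow>0\<rightarrow> \<rho> \<and> (\<lambda>h. h * w (s + h)) \<midarrow>0\<rightarrow> \<rho>" if "is_pole g s \<or> is_pole w s" for s
  proof (intro exI conjI)
    have s: "exp s = 1"
      using that poles w[of s] analytic_at_imp_no_pole by blast
    thus "(\<lambda>h. h * g (s + h)) \<midarrow>0\<rightarrow> \<rho>" by (intro res) (simp add: poles)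
    have "((\<lambda>h::complex. (exp (0 + h) - exp 0) / h) \<longlongrightarrow> exp 0) (at 0)"
      using DERIV_exp[of "0::complex"] unfolding DERIV_def .
    hence "((\<lambda>h::complex. \<rho> / ((exp (0 + h) - exp 0) / h)) \<longlongrightarrow> \<rho> / exp 0) (at 0)"
      by (intro tendsto_intros) auto
    thus "(\<lambda>h. h * w (s + h)) \<midarrow>0\<rightarrow> \<rho>" using s by (simp add: w_def exp_add mult.commute)
  qed
  then obtain f where f: "f holomorphic_on UNIV" "\<And>s. g analytic_on {s} \<Longrightarrow> w analytic_on {s} \<Longrightarrow> f s = g s - w s"
    using entire_difference[OF mero wm] by blast
  have f_eq: "f s = g s - w s" if "exp s \<noteq> 1" for s using f(2) an w that by blast
  have f_nice: "f nicely_meromorphic_on UNIV"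
    using f(1) by (intro analytic_on_imp_nicely_meromorphic_on) (simp add: analytic_on_open)
  \<comment> \<open>\<open>f\<close> equals \<open>g - w\<close> only away from the poles, so its
    period is first verified near the pole-free point 1 and then continued.\<close>
  have f_per: "f (s + 2 * pi * \<i>) = f s" for s
  proof (rule nicely_meromorphic_identity[of "\<lambda>s. f (s + 2 * pi * \<i>)" f 1])
    show "(\<lambda>s. f (s + 2 * pi * \<i>)) nicely_meromorphic_on UNIV"
      using nicely_meromorphic_on_affine[OF f_nice, of 1 "2 * pi * \<i>"] by simp
    have "eventually (\<lambda>s::complex. s \<in> {s. Re s > 0} - {1}) (at 1)"
      by (intro eventually_at_in_open open_halfspace_Re_gt) simp
    thus "eventually (\<lambda>s. f (s + 2 * pi * \<i>) = f s) (at 1)"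
    proof eventually_elim
      case (elim s)
      have e: "exp (s + 2 * pi * \<i>) = exp s" by (simp add: exp_add exp_two_pi_i)
      have "norm (exp s) \<noteq> 1" using elim by simp
      hence "exp s \<noteq> 1" by (metis norm_one)
      thus ?case using f_eq[of s] f_eq[of "s + 2 * pi * \<i>"] per[of s] e by (simp add: w_def)
    qed
  qed (rule f_nice)
  have Re0: "Re s = 0" if "is_pole g s" for s
  proof -
    have "norm (exp s) = 1" using that poles by simp
    thus ?thesis by simp
  qed
  obtain C1 n1 where 1: "\<And>s. Re s \<ge> 1 \<Longrightarrow> norm (g s) \<le> C1 * Re s ^ n1"
    using periodic_ode_growth[OF sol AB per] Re0 by (metis order_refl)
  \<comment> \<open>The left half-plane is reached by the reflection \<open>s \<mapsto> - s\<close>,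
    which transforms the equation into one of the same kind with \<open>A + B\<close> replaced by
    its negative.\<close>
  have "\<exists>C (n::nat). \<forall>s. Re s \<ge> 1 \<longrightarrow> norm (g (- 1 * s + 0)) \<le> C * Re s ^ n"
  proof (rule periodic_ode_growth[OF ode_solution_affine[OF sol, of "- 1" 0]])
    show "(- 1 :: complex) \<noteq> 0" "- 1 * A + - 1 * B \<noteq> 0" using AB by (auto simp: add_eq_0_iff)
    show "g (- 1 * (s + 2 * pi * \<i>) + 0) = g (- 1 * s + 0)" for s
      using per[of "- s - 2 * pi * \<i>"] by simp
    show "Re s \<le> 0" if "is_pole (\<lambda>s. g (- 1 * s + 0)) s" for s
      using that Re0[of "- s"] is_pole_affine[of "- 1" g 0 s] by simp
  qed
  then obtain C2 n2 where "\<And>s. Re s \<ge> 1 \<Longrightarrow> norm (g (- 1 * s + 0)) \<le> C2 * Re s ^ n2" by blast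
  hence 2: "norm (g s) \<le> C2 * (- Re s) ^ n2" if "Re s \<le> - 1" for s
    using that by (metis (no_types) add.right_neutral minus_minus mult_minus1 neg_le_iff_le uminus_complex.sel(1))
  have "norm (f s) \<le> (\<bar>C1\<bar> + \<bar>C2\<bar> + 2 * norm \<rho>) * norm s ^ (n1 + n2)" if s: "1 \<le> \<bar>Re s\<bar>" for s
  proof -
    define N where "N = norm s ^ (n1 + n2)"
    have s1: "1 \<le> norm s" using s abs_Re_le_cmod[of s] by linarith
    have pw: "\<bar>Re s\<bar> ^ m \<le> N" if "m \<le> n1 + n2" for m
      using abs_Re_le_cmod[of s] s1 that unfolding N_def
      by (meson abs_ge_zero order_trans power_increasing power_mono)
    have N1: "1 \<le> N" using s1 by (simp add: N_def one_le_power)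
    have ne: "exp s \<noteq> 1"
    proof
      assume "exp s = 1"
      thus False using Re0[of s] poles s by simp
    qed
    have g: "norm (g s) \<le> (\<bar>C1\<bar> + \<bar>C2\<bar>) * N"
    proof (cases "Re s \<ge> 1")
      case True
      have "norm (g s) \<le> C1 * Re s ^ n1" by (rule 1[OF True])
      also have "\<dots> \<le> (\<bar>C1\<bar> + \<bar>C2\<bar>) * N" using pw[of n1] True N1 by (intro mult_mono) auto
      finally show ?thesis .
    next
      case False
      hence neg: "Re s \<le> - 1" using s by linarith
      have "norm (g s) \<le> C2 * (- Re s) ^ n2" by (rule 2[OF neg])
      also have "\<dots> \<le> (\<bar>C1\<bar> + \<bar>C2\<bar>) * N" using pw[of n2] neg N1 by (intro mult_mono) auto
      finally show ?thesis .
    qed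
    have "1/2 \<le> norm (exp s - 1)"
    proof (cases "Re s \<ge> 1")
      case True
      have "2 \<le> exp (Re s)" using exp_ge_add_one_self[of "Re s"] True by linarith
      thus ?thesis using norm_triangle_ineq2[of "exp s" 1] by simp
    next
      case False
      hence "2 \<le> exp (- Re s)" using exp_ge_add_one_self[of "- Re s"] s by linarith
      hence "exp (Re s) \<le> 1/2" by (simp add: exp_minus field_simps)
      thus ?thesis using norm_triangle_ineq2[of 1 "exp s"] by (simp add: norm_minus_commute)
    qed
    hence "norm (w s) \<le> norm \<rho> / (1/2)"
      unfolding w_def norm_divide by (intro divide_left_mono) auto
    also have "\<dots> \<le> 2 * norm \<rho> * N" using mult_left_mono[OF N1, of "2 * norm \<rho>"] by (simp add: mult_ac)
    finally have "norm (w s) \<le> 2 * norm \<rho> * N" .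
    moreover have "norm (f s) \<le> norm (g s) + norm (w s)"
      unfolding f_eq[OF ne] by (rule norm_triangle_ineq4)
    ultimately show ?thesis using g by (simp add: N_def[symmetric] algebra_simps)
  qed
  hence const: "f s = f 0" for s using periodic_entire_poly_growth_const[OF f(1) f_per] by blast
  show ?thesis
    by (rule that[of "f 0"]) (metis f_eq const w_def diff_add_cancel add.commute)
qed

text \<open>Every difference of poles is a period. A nearest pole to \<open>z0\<close> gives a
  minimal period; it generates all poles, because a further one would yield either a period off the
  imaginary axis or a shorter one.\<close>

lemma ode_solution_two_poles:
  assumes sol: "ode_solution A B \<alpha> \<beta> \<gamma> \<delta> v" and AB: "A + B \<noteq> 0"
    and pole_order: "\<And>n::nat. n \<ge> 2 \<Longrightarrow> of_nat n * (A + B) + B \<noteq> 0"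
    and indices: "\<And>n::nat. A + 2 * B \<noteq> 0 \<Longrightarrow> n \<ge> 1 \<Longrightarrow> (A + 2 * B) * of_nat n ^ 2 - (7 * A + 8 * B) * of_nat n + 6 * (A + 2 * B) \<noteq> 0"
    and poles: "is_pole v z0" "is_pole v z'" "z' \<noteq> z0"
  obtains h0 k \<zeta>0 c0 where "h0 \<noteq> 0" "k \<noteq> 0" "\<zeta>0 \<noteq> 0"
    "\<And>z. \<not> is_pole v z \<Longrightarrow> v z = h0 / (exp (k * z) - \<zeta>0) + c0"
proof -
  have nice: "v nicely_meromorphic_on UNIV" using sol by (simp add: ode_solution_def)
  \<comment> \<open>Only finitely many poles are as close to \<open>z0\<close> as \<open>z'\<close>
    is, so a nearest one exists.\<close>
  define S where "S = cball z0 (dist z0 z') \<inter> {z. is_pole v z} - {z0}"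
  have "finite S"
    unfolding S_def using nicely_meromorphic_poles_discrete(2)[OF nice compact_cball] by simp
  moreover have "z' \<in> S" using poles by (simp add: S_def)
  ultimately obtain z1 where z1: "z1 \<in> S" "\<And>z. z \<in> S \<Longrightarrow> dist z0 z1 \<le> dist z0 z"
    using ex_min_if_finite[of "dist z0 ` S"] by (metis arg_min_if_finite(1) arg_min_least empty_iff)
  have z1_pole: "is_pole v z1" "z1 \<noteq> z0" using z1(1) by (simp_all add: S_def)
  have min: "dist z0 z1 \<le> dist z0 z" if "is_pole v z" "z \<noteq> z0" for z
  proof (cases "z \<in> S")
    case False
    hence "dist z0 z' < dist z0 z" using that by (simp add: S_def)
    thus ?thesis using z1(2)[OF \<open>z' \<in> S\<close>] by simp
  qed (rule z1(2))
  define \<kappa> where "\<kappa> = (z1 - z0) / (2 * pi * \<i>)"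
  have kappa: "\<kappa> \<noteq> 0" using z1_pole by (simp add: \<kappa>_def)
  have kappa2: "\<kappa> * (2 * pi * \<i>) = z1 - z0" by (simp add: \<kappa>_def)
  define g where "g = (\<lambda>s. v (\<kappa> * s + z0))"
  have gpole: "is_pole g s \<longleftrightarrow> is_pole v (\<kappa> * s + z0)" for s
    unfolding g_def by (rule is_pole_affine[OF kappa])
  have gsol: "ode_solution (\<kappa> * A) (\<kappa> * B) (\<kappa> * \<alpha>) (\<kappa>\<^sup>2 * \<beta>) (\<kappa> ^ 3 * \<gamma>) (\<kappa> ^ 3 * \<delta>) g"
    unfolding g_def by (rule ode_solution_affine[OF sol kappa])
  have gnice: "g nicely_meromorphic_on UNIV" using gsol by (simp add: ode_solution_def)
  have gAB: "\<kappa> * A + \<kappa> * B \<noteq> 0" using AB kappa by (simp flip: distrib_left)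
  \<comment> \<open>The conditions on \<open>A\<close> and \<open>B\<close> are homogeneous of
    degree 1, so the rescaling only multiplies them by \<open>\<kappa>\<close>.\<close>
  have gorder: "of_nat n * (\<kappa> * A + \<kappa> * B) + \<kappa> * B \<noteq> 0" if "n \<ge> 2" for n :: nat
  proof -
    have "of_nat n * (\<kappa> * A + \<kappa> * B) + \<kappa> * B = \<kappa> * (of_nat n * (A + B) + B)" by (simp add: algebra_simps)
    thus ?thesis using pole_order[OF that] kappa by (metis mult_eq_0_iff)
  qed
  have gindices: "(\<kappa> * A + 2 * (\<kappa> * B)) * of_nat n ^ 2 - (7 * (\<kappa> * A) + 8 * (\<kappa> * B)) * of_nat n + 6 * (\<kappa> * A + 2 * (\<kappa> * B)) \<noteq> 0"
    if "\<kappa> * A + 2 * (\<kappa> * B) \<noteq> 0" "n \<ge> 1" for n :: nat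
  proof -
    have "A + 2 * B \<noteq> 0"
    proof
      assume "A + 2 * B = 0"
      hence "\<kappa> * (A + 2 * B) = 0" by simp
      thus False using that(1) by (simp add: algebra_simps)
    qed
    moreover have "(\<kappa> * A + 2 * (\<kappa> * B)) * of_nat n ^ 2 - (7 * (\<kappa> * A) + 8 * (\<kappa> * B)) * of_nat n + 6 * (\<kappa> * A + 2 * (\<kappa> * B))
        = \<kappa> * ((A + 2 * B) * of_nat n ^ 2 - (7 * A + 8 * B) * of_nat n + 6 * (A + 2 * B))"
      by (simp add: algebra_simps)
    ultimately show ?thesis using indices[OF _ that(2)] kappa by (metis mult_eq_0_iff)
  qed
  have res_ne_0: "residue g q \<noteq> 0" if "is_pole g q" for q
    by (rule ode_solution_poles(1)[OF gsol gorder gindices that])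
  have res_eq: "(\<kappa> * A + 2 * (\<kappa> * B)) * residue g q = - 6" if "is_pole g q" for q
    by (rule ode_solution_poles(2)[OF gsol gorder gindices that])
  have res_lim: "(\<lambda>h. h * g (q + h)) \<midarrow>0\<rightarrow> residue g q" if "is_pole g q" for q
    by (rule ode_solution_poles(3)[OF gsol gorder gindices that])
  have pole0: "is_pole g 0" using poles(1) by (simp add: gpole)
  have pole1: "is_pole g (2 * pi * \<i>)" using z1_pole(1) by (simp only: gpole kappa2) simp
  have period: "g (s + q) = g s" if "is_pole g q" for s q
  proof -
    have "g (s + (q - 0)) = g s" by (rule ode_solution_poles(4)[OF gsol gorder gindices pole0 that])
    thus ?thesis by simp
  qed
  have per: "g (s + 2 * pi * \<i>) = g s" for s by (rule period[OF pole1])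
  define \<rho> where "\<rho> = residue g 0"
  have rho: "\<rho> \<noteq> 0" using res_ne_0[OF pole0] by (simp add: \<rho>_def)
  have res: "residue g q = \<rho>" if "is_pole g q" for q
  proof -
    have "(\<kappa> * A + 2 * (\<kappa> * B)) * residue g q = (\<kappa> * A + 2 * (\<kappa> * B)) * \<rho>"
      using res_eq[OF that] res_eq[OF pole0] by (simp add: \<rho>_def)
    moreover have "\<kappa> * A + 2 * (\<kappa> * B) \<noteq> 0" using res_eq[OF pole0] by auto
    ultimately show ?thesis by (metis mult_left_cancel)
  qed
  have shift: "is_pole g (s + of_int k * (2 * pi * \<i>)) \<longleftrightarrow> is_pole g s" for s k
    using is_pole_affine[of 1 g "of_int k * (2 * pi * \<i>)" s] periodic_of_int_mult[of g, OF per] by simp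
  have pole_iff: "is_pole g s \<longleftrightarrow> exp s = 1" for s
  proof
    assume "exp s = 1"
    then obtain k :: int where "s = of_int k * (2 * pi * \<i>)" by (auto simp: exp_eq_1_iff_of_int)
    thus "is_pole g s" using shift[of 0 k] pole0 by simp
  next
    assume s: "is_pole g s"
    have Re: "Re s = 0"
      using no_second_period[OF gnice per period[OF s] _ pole0 res rho] by blast
    define k where "k = \<lfloor>Im s / (2 * pi)\<rfloor>"
    define t where "t = s + of_int (- k) * (2 * pi * \<i>)"
    have t_pole: "is_pole g t" unfolding t_def shift by (rule s)
    have "Im t = frac (Im s / (2 * pi)) * (2 * pi)" by (simp add: t_def k_def frac_def algebra_simps)
    hence Im_t: "0 \<le> Im t" "Im t < 2 * pi"
      using frac_ge_0[of "Im s / (2 * pi)"] frac_lt_1[of "Im s / (2 * pi)"] by (simp_all del: frac_ge_0)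
    have Re_t: "Re t = 0" by (simp add: t_def Re)
    have norm_t: "norm t < 2 * pi" using Im_t Re_t by (simp add: cmod_eq_Im)
    have "t = 0"
    proof (rule ccontr)
      assume "t \<noteq> 0"
      hence "dist z0 z1 \<le> dist z0 (\<kappa> * t + z0)"
        using min[of "\<kappa> * t + z0"] t_pole kappa by (simp add: gpole)
      hence "norm (\<kappa> * (2 * pi * \<i>)) \<le> norm (\<kappa> * t)"
        unfolding kappa2 by (simp add: dist_norm norm_minus_commute)
      thus False using norm_t kappa by (simp add: norm_mult)
    qed
    hence "s = of_int k * (2 * pi * \<i>)" by (simp add: t_def)
    thus "exp s = 1" by (auto simp: exp_eq_1_iff_of_int)
  qed
  obtain c0 where g_eq: "\<And>s. exp s \<noteq> 1 \<Longrightarrow> g s = \<rho> / (exp s - 1) + c0"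
    using periodic_ode_solution[OF gsol gAB per pole_iff, of \<rho>] res_lim res by metis
  \<comment> \<open>In the original variable \<open>exp s = exp (z / \<kappa>) / \<zeta>\<close>;
    clearing this denominator gives \<open>h0 = \<rho> * \<zeta>\<close> and
    \<open>k = 1 / \<kappa>\<close>.\<close>
  define \<zeta> where "\<zeta> = exp (z0 / \<kappa>)"
  have zeta: "\<zeta> \<noteq> 0" by (simp add: \<zeta>_def)
  show ?thesis
  proof (rule that[of "\<rho> * \<zeta>" "1 / \<kappa>" \<zeta> c0])
    fix z assume z: "\<not> is_pole v z"
    define s where "s = (z - z0) / \<kappa>"
    have zs: "z = \<kappa> * s + z0" using kappa by (simp add: s_def)
    have ne: "exp s \<noteq> 1" using z by (simp add: zs flip: gpole pole_iff)
    have e: "exp (1 / \<kappa> * z) = exp s * \<zeta>"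
      using kappa by (simp add: s_def \<zeta>_def diff_divide_distrib flip: exp_add)
    have "v z = \<rho> / (exp s - 1) + c0" using g_eq[OF ne] by (simp add: g_def zs)
    also have "\<rho> / (exp s - 1) = (\<rho> * \<zeta>) / ((exp s - 1) * \<zeta>)" using zeta by simp
    also have "(exp s - 1) * \<zeta> = exp (1 / \<kappa> * z) - \<zeta>" unfolding e by (simp add: algebra_simps)
    finally show "v z = \<rho> * \<zeta> / (exp (1 / \<kappa> * z) - \<zeta>) + c0" .
  qed (use rho zeta kappa in auto)
qed

section \<open>From the stated conditions to the final case distinction\<close>

lemma quadratic_root_csqrt:
  fixes a b c x :: complex
  assumes "a \<noteq> 0" and "a * x\<^sup>2 - b * x + c = 0"
  shows "x = (b + csqrt (b\<^sup>2 - 4 * a * c)) / (2 * a) \<or> x = (b - csqrt (b\<^sup>2 - 4 * a * c)) / (2 * a)"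
proof -
  have "(2 * a * x - b)\<^sup>2 = 4 * a * (a * x\<^sup>2 - b * x + c) + (b\<^sup>2 - 4 * a * c)"
    by (simp add: power2_eq_square algebra_simps)
  also have "\<dots> = (csqrt (b\<^sup>2 - 4 * a * c))\<^sup>2" using assms(2) by simp
  finally have "2 * a * x - b = csqrt (b\<^sup>2 - 4 * a * c) \<or> 2 * a * x - b = - csqrt (b\<^sup>2 - 4 * a * c)"
    by (simp only: power2_eq_iff)
  thus ?thesis using assms(1) by (auto simp: field_simps)
qed

theorem theorem1:
  fixes A B \<alpha> \<beta> \<gamma> \<delta> :: real and u :: "complex \<Rightarrow> complex"
  assumes cond_i: "A * B * (A + B) \<noteq> 0"
    and cond_ii: "B / (A + B) \<notin> \<int> - {0}"
    and cond_iii: "A + 2 * B \<noteq> 0 \<Longrightarrow>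
        (\<forall>s \<in> {1, -1 :: complex}.
           (of_real (7 * A + 8 * B) + s * csqrt (of_real (25 * A\<^sup>2 + 16 * A * B - 32 * B\<^sup>2)))
             / of_real (2 * (A + 2 * B)) \<notin> \<nat>)"
    and mero: "u meromorphic_on UNIV"
    and ode: "\<And>z. u analytic_on {z} \<Longrightarrow>
        of_real A * (deriv u z)\<^sup>2 + of_real B * u z * deriv (deriv u) z
          = deriv (deriv (deriv u)) z + of_real \<alpha> * deriv (deriv u) z
            + of_real \<beta> * deriv u z + of_real \<gamma> * u z + of_real \<delta>"
  shows "(\<exists>u0 z0 :: complex. \<exists>P :: complex poly. degree P \<le> 2 \<and>
            (\<forall>z. u analytic_on {z} \<longrightarrow> u z = u0 / (z - z0) + poly P z))
       \<or> (\<exists>h0 k \<zeta>0 c0 :: complex. h0 \<noteq> 0 \<and> k \<noteq> 0 \<and> \<zeta>0 \<noteq> 0 \<and>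
            (\<forall>z. u analytic_on {z} \<longrightarrow> u z = h0 / (exp (k * z) - \<zeta>0) + c0))"
proof -
  define v where "v = remove_sings u"
  define A' B' where "A' = complex_of_real A" and "B' = complex_of_real B"
  have sol: "ode_solution A' B' \<alpha> \<beta> \<gamma> \<delta> v"
    unfolding v_def by (rule ode_solution_remove_sings[OF mero]) (simp add: ode_at_def A'_def B'_def ode)
  have uv: "u z = v z" "\<not> is_pole v z" if "u analytic_on {z}" for z
  proof -
    show "u z = v z" using that by (simp add: v_def)
    have "v analytic_on {z}" unfolding v_def using that by (simp add: remove_sings_analytic_on)
    thus "\<not> is_pole v z" using analytic_at_imp_no_pole by blast
  qed
  have AB: "A + B \<noteq> 0" and B0: "B \<noteq> 0" using cond_i by auto
  have AB': "A' + B' \<noteq> 0" using AB by (simp add: A'_def B'_def flip: of_real_add)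
  \<comment> \<open>As \<open>B\<close> is nonzero by (i), the quotient in (ii) is no integer at
    all. Negative \<open>k\<close> will exclude multiple poles, positive \<open>k\<close> polynomial
    parts of degree at least 3.\<close>
  have not_int: "of_int k * (A + B) \<noteq> B" for k :: int
  proof
    assume "of_int k * (A + B) = B"
    hence "B / (A + B) = of_int k" using AB by (simp add: field_simps)
    moreover have "B / (A + B) \<noteq> 0" using AB B0 by simp
    ultimately show False using cond_ii by auto
  qed
  have pole_order: "of_nat n * (A' + B') + B' \<noteq> 0" for n :: nat
  proof
    assume "of_nat n * (A' + B') + B' = 0"
    hence "complex_of_real (of_nat n * (A + B) + B) = 0" by (simp add: A'_def B'_def)
    hence "of_nat n * (A + B) + B = 0" by (simp only: of_real_eq_0_iff)
    thus False using not_int[of "- int n"] by simp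
  qed
  have poly_degree: "of_nat n * (A' + B') \<noteq> B'" for n :: nat
  proof
    assume "of_nat n * (A' + B') = B'"
    hence "complex_of_real (of_nat n * (A + B)) = of_real B" by (simp add: A'_def B'_def)
    hence "of_nat n * (A + B) = B" by (simp only: of_real_eq_iff)
    thus False using not_int[of "int n"] by simp
  qed
  have indices: "(A' + 2 * B') * of_nat n ^ 2 - (7 * A' + 8 * B') * of_nat n + 6 * (A' + 2 * B') \<noteq> 0"
    if "A' + 2 * B' \<noteq> 0" for n :: nat
  proof
    assume root: "(A' + 2 * B') * of_nat n ^ 2 - (7 * A' + 8 * B') * of_nat n + 6 * (A' + 2 * B') = 0"
    have A2B: "A + 2 * B \<noteq> 0"
    proof
      assume "A + 2 * B = 0"
      hence "complex_of_real (A + 2 * B) = 0" by simp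
      thus False using that by (simp add: A'_def B'_def)
    qed
    define s where "s = csqrt (of_real (25 * A\<^sup>2 + 16 * A * B - 32 * B\<^sup>2))"
    \<comment> \<open>The radicand in (iii) is the discriminant of the indicial quadratic, so (iii)
      says that no root is a natural number.\<close>
    have "(7 * A' + 8 * B')\<^sup>2 - 4 * (A' + 2 * B') * (6 * (A' + 2 * B')) = of_real (25 * A\<^sup>2 + 16 * A * B - 32 * B\<^sup>2)"
      by (simp add: A'_def B'_def power2_eq_square algebra_simps)
    hence "of_nat n = (7 * A' + 8 * B' + s) / (2 * (A' + 2 * B')) \<or> of_nat n = (7 * A' + 8 * B' - s) / (2 * (A' + 2 * B'))"
      using quadratic_root_csqrt[OF that root] by (simp only: s_def)
    hence "(7 * A' + 8 * B' + s) / (2 * (A' + 2 * B')) \<in> \<nat> \<or> (7 * A' + 8 * B' - s) / (2 * (A' + 2 * B')) \<in> \<nat>"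
      by (metis of_nat_in_Nats)
    moreover have "(of_real (7 * A + 8 * B) + 1 * s) / of_real (2 * (A + 2 * B)) \<notin> \<nat>"
      "(of_real (7 * A + 8 * B) + - 1 * s) / of_real (2 * (A + 2 * B)) \<notin> \<nat>"
      using cond_iii[OF A2B] unfolding s_def by blast+
    moreover have "of_real (7 * A + 8 * B) = 7 * A' + 8 * B'" "of_real (2 * (A + 2 * B)) = 2 * (A' + 2 * B')"
      by (simp_all add: A'_def B'_def)
    ultimately show False by simp
  qed
  show ?thesis
  proof (cases "\<exists>z0 z1. is_pole v z0 \<and> is_pole v z1 \<and> z1 \<noteq> z0")
    case True
    then obtain z0 z1 where "is_pole v z0" "is_pole v z1" "z1 \<noteq> z0" by blast
    then obtain h0 k \<zeta>0 c0 where "h0 \<noteq> 0" "k \<noteq> 0" "\<zeta>0 \<noteq> 0"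
      "\<And>z. \<not> is_pole v z \<Longrightarrow> v z = h0 / (exp (k * z) - \<zeta>0) + c0"
      using ode_solution_two_poles[OF sol AB' pole_order indices] by metis
    thus ?thesis using uv by metis
  next
    case False
    \<comment> \<open>Without any pole \<open>z0\<close> is arbitrary; otherwise it is the only one.
      Translating it to 0 matches the hypotheses of \<open>ode_solution_rational\<close>.\<close>
    then obtain z0 where z0: "\<And>z. is_pole v z \<Longrightarrow> z = z0" by metis
    have sol0: "ode_solution A' B' \<alpha> \<beta> \<gamma> \<delta> (\<lambda>w. v (1 * w + z0))"
      using ode_solution_affine[OF sol, of 1 z0] by simp
    have pole0: "is_pole (\<lambda>w. v (1 * w + z0)) w \<longleftrightarrow> is_pole v (w + z0)" for w
      using is_pole_affine[of 1 v z0 w] by simp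
    obtain u0 P where P: "degree P \<le> 2" "\<And>w. \<not> is_pole v (w + z0) \<Longrightarrow> v (w + z0) = u0 / w + poly P w"
      using ode_solution_rational[OF sol0 AB' pole_order poly_degree indices] z0
      unfolding pole0 by (metis add_0 add_right_cancel mult_1)
    define R where "R = P \<circ>\<^sub>p [:- z0, 1:]"
    have "degree R \<le> 2" using P(1) by (simp add: R_def degree_pcompose)
    moreover have "u z = u0 / (z - z0) + poly R z" if "u analytic_on {z}" for z
      using P(2)[of "z - z0"] uv[OF that] by (simp add: R_def poly_pcompose)
    ultimately show ?thesis by blast
  qed
qed

end
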